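(* Let $\Phi$ be a continuous distribution function which is asymptotically generalized Gaussian (AGG) on the right with exponent $\gamma\ge 1$. Fix $\beta\in(0,1)$, $r\ge 0$ and $\nu>1$ such that the real power $(\nu^{1/\gamma}-r^{1/\gamma})^\gamma$ is defined (that is, $r\le\nu$ or $\gamma$ is an integer), and let $q=q(n)>0$ satisfy $n^a q(n)\to\infty$ as $n\to\infty$ for every fixed $a>0$. For each $n$, consider the static mixture model with null distribution $\Phi$, mixture weight $\varepsilon=n^{-\beta}$ and shift $\mu=(\gamma r\log n)^{1/\gamma}$, and apply the LOND procedure with the sequence $(\lambda_i)_{i\ge1}$ given by $\lambda_i\propto i^{-\nu}$ and $\sum_{i=1}^\infty\lambda_i=q(n)$. If $$r>\beta+(\nu^{1/\gamma}-r^{1/\gamma})^\gamma+\nu-1,$$ then the false non-discovery rate of LOND on the first $n$ hypotheses satisfies $\mathrm{FNR}_n\to0$ as $n\to\infty$. In particular, if in addition $q(n)\to0$, then the risk $\mathrm{FDR}_n+\mathrm{FNR}_n$ of LOND tends to $0$ as $n\to\infty$.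
   Context: AGG: a distribution function $\Phi$ with $\bar\Phi=1-\Phi$ is asymptotically generalized Gaussian on the right with exponent $\gamma>0$ if $\lim_{x\to\infty}x^{-\gamma}\log\bar\Phi(x)=-1/\gamma$. Static mixture model (parameters $\Phi,\varepsilon,\mu$): there is a stream of null hypotheses $H_1,H_2,\dots$ with independent test statistics $X_1,X_2,\dots$. The $i$-th hypothesis has a shift $\mu_i\in\{0,\mu\}$; the $\mu_i$ are i.i.d. with $\mathbb P(\mu_i=\mu)=\varepsilon$ and $\mathbb P(\mu_i=0)=1-\varepsilon$, and conditionally on $(\mu_i)$ the $X_i$ are independent with $X_i$ having distribution function $\Phi(\cdot-\mu_i)$. The null $H_i$ is true if $\mu_i=0$ and false if $\mu_i=\mu$. The P-values are $P_i=\bar\Phi(X_i)$. The parameters depend on $n$, and performance is measured on the first $n$ hypotheses. Sequential procedures: each procedure uses levels $\alpha_i$ that depend only on $P_1,\dots,P_{i-1}$ (with $\alpha_1$ deterministic), and rejects $H_i$ (makes a discovery at time $i$) if and only if $P_i\le\alpha_i$. LOND: given $\lambda_i\ge0$ with $\sum_i\lambda_i=q$, set $\alpha_i=\lambda_i\,(D(i-1)+1)$, where $D(k)$ is the number of rejected hypotheses among $H_1,\dots,H_k$ and $D(0)=0$. Error rates: let $F_n\subset\{1,\dots,n\}$ be the set of indices of false nulls and $R_n\subset\{1,\dots,n\}$ the set of indices of rejected hypotheses among the first $n$. Then $\mathrm{FDR}_n=\mathbb E\big[|R_n\setminus F_n|/|R_n|\big]$ and $\mathrm{FNR}_n=\mathbb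 E\big[|F_n\setminus R_n|/|F_n|\big]$, with the convention $0/0=0$. *)

theory Defs
  imports "HOL-Probability.Probability"
begin

definition distribution_function :: "(real \<Rightarrow> real) \<Rightarrow> bool" where
  "distribution_function \<Phi> \<longleftrightarrow> (\<exists>Q. real_distribution Q \<and> \<Phi> = cdf Q)"

text \<open>
  A distribution function with \<open>\<Phi> x = 1\<close> for all large \<open>x\<close> is excluded here, as it should be:
  since \<open>ln 0 = 0\<close>, the limit would be \<open>0\<close>.
\<close>
definition agg_right :: "(real \<Rightarrow> real) \<Rightarrow> real \<Rightarrow> bool" where
  "agg_right \<Phi> \<gamma> \<longleftrightarrow> \<gamma> > 0 \<and>
     ((\<lambda>x. x powr (-\<gamma>) * ln (1 - \<Phi> x)) \<longlongrightarrow> - (1 / \<gamma>)) at_top"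

text \<open>
  The real power \<open>x\<^sup>a\<close> for \<open>x \<ge> 0\<close>, or for \<open>x < 0\<close> and integral \<open>a\<close>. The function
  \<open>powr\<close> cannot be used in the second case, as it loses the sign of a negative base. For
  \<open>x < 0\<close> and non-integral \<open>a\<close> the value is meaningless.
\<close>
definition real_power :: "real \<Rightarrow> real \<Rightarrow> real" where
  "real_power x a = (if x \<ge> 0 then x powr a else x powi \<lfloor>a\<rfloor>)"


text \<open>
  Hypotheses are indexed by the positive integers. The event \<open>\<theta> i \<omega>\<close> says that the \<open>i\<close>-th null
  is false, so that the \<open>i\<close>-th shift is \<open>shift \<mu> (\<theta> i \<omega>)\<close>. Using the indicator \<open>\<theta> i\<close> rather
  than the shift as the primitive keeps true and false nulls apart also when \<open>\<mu> = 0\<close>; for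
  \<open>\<mu> \<noteq> 0\<close> the two determine each other.
\<close>
definition shift :: "real \<Rightarrow> bool \<Rightarrow> real" where
  "shift \<mu> b = (if b then \<mu> else 0)"

definition null_algebra :: "'a measure \<Rightarrow> (nat \<Rightarrow> 'a \<Rightarrow> bool) \<Rightarrow> 'a measure" where
  "null_algebra M \<theta> = vimage_algebra (space M) (\<lambda>\<omega>. \<lambda>i\<in>{1..}. \<theta> i \<omega>)
     (\<Pi>\<^sub>M i\<in>{1..}. count_space UNIV)"

text \<open>
  The last conjunct says that, conditionally on all the indicators, the \<open>X i\<close> are independent
  with distribution functions \<open>\<lambda>x. \<Phi> (x - shift \<mu> (\<theta> i \<omega>))\<close>.
\<close>
definition static_mixture ::
  "(real \<Rightarrow> real) \<Rightarrow> real \<Rightarrow> real \<Rightarrow> 'a measure \<Rightarrow> (nat \<Rightarrow> 'a \<Rightarrow> bool) \<Rightarrow> (nat \<Rightarrow> 'a \<Rightarrow> real) \<Rightarrow> bool"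
where
  "static_mixture \<Phi> \<epsilon> \<mu> M \<theta> X \<longleftrightarrow>
     prob_space M \<and>
     prob_space.indep_vars M (\<lambda>_. count_space UNIV) \<theta> {1..} \<and>
     (\<forall>i\<ge>1. measure M {\<omega> \<in> space M. \<theta> i \<omega>} = \<epsilon>) \<and>
     (\<forall>i\<ge>1. X i \<in> borel_measurable M) \<and>
     (\<forall>I x. finite I \<and> I \<subseteq> {1..} \<longrightarrow>
        (AE \<omega> in M.
           real_cond_exp M (null_algebra M \<theta>)
             (indicator {\<omega> \<in> space M. \<forall>i\<in>I. X i \<omega> \<le> x i}) \<omega>
           = (\<Prod>i\<in>I. \<Phi> (x i - shift \<mu> (\<theta> i \<omega>)))))"

definition p_value :: "(real \<Rightarrow> real) \<Rightarrow> (nat \<Rightarrow> 'a \<Rightarrow> real) \<Rightarrow> 'a \<Rightarrow> nat \<Rightarrow> real" where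
  "p_value \<Phi> X \<omega> i = 1 - \<Phi> (X i \<omega>)"


text \<open>
  The number of discoveries and the levels of LOND depend on each other. The recursion is
  solved for the number of discoveries; the defining property of the latter is
  lemma \<open>lond_discoveries_eq_card\<close>.
\<close>
primrec lond_discoveries :: "(nat \<Rightarrow> real) \<Rightarrow> (nat \<Rightarrow> real) \<Rightarrow> nat \<Rightarrow> nat" where
  "lond_discoveries \<Lambda> p 0 = 0"
| "lond_discoveries \<Lambda> p (Suc k) = lond_discoveries \<Lambda> p k +
     (if p (Suc k) \<le> \<Lambda> (Suc k) * (real (lond_discoveries \<Lambda> p k) + 1) then 1 else 0)"

definition lond_level :: "(nat \<Rightarrow> real) \<Rightarrow> (nat \<Rightarrow> real) \<Rightarrow> nat \<Rightarrow> real" where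
  "lond_level \<Lambda> p i = \<Lambda> i * (real (lond_discoveries \<Lambda> p (i - 1)) + 1)"

definition lond_rejected :: "(nat \<Rightarrow> real) \<Rightarrow> (nat \<Rightarrow> real) \<Rightarrow> nat \<Rightarrow> nat set" where
  "lond_rejected \<Lambda> p n = {i \<in> {1..n}. p i \<le> lond_level \<Lambda> p i}"

lemma lond_discoveries_eq_card: "lond_discoveries \<Lambda> p k = card (lond_rejected \<Lambda> p k)"
proof (induction k)
  case 0
  show ?case by (simp add: lond_rejected_def)
next
  case (Suc k)
  have "lond_rejected \<Lambda> p (Suc k) =
      (if p (Suc k) \<le> lond_level \<Lambda> p (Suc k) then insert (Suc k) (lond_rejected \<Lambda> p k)
       else lond_rejected \<Lambda> p k)"
    by (auto simp: lond_rejected_def le_Suc_eq)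
  moreover have "Suc k \<notin> lond_rejected \<Lambda> p k" "finite (lond_rejected \<Lambda> p k)"
    by (auto simp: lond_rejected_def)
  ultimately show ?case
    using Suc by (simp add: lond_level_def)
qed

definition power_weights :: "real \<Rightarrow> real \<Rightarrow> (nat \<Rightarrow> real) \<Rightarrow> bool" where
  "power_weights \<nu> q \<Lambda> \<longleftrightarrow>
     (\<exists>c. \<forall>i\<ge>1. \<Lambda> i = c * real i powr (-\<nu>)) \<and> (\<lambda>i. \<Lambda> (Suc i)) sums q"


definition false_nulls :: "(nat \<Rightarrow> 'a \<Rightarrow> bool) \<Rightarrow> nat \<Rightarrow> 'a \<Rightarrow> nat set" where
  "false_nulls \<theta> n \<omega> = {i \<in> {1..n}. \<theta> i \<omega>}"

text \<open>The convention \<open>0 / 0 = 0\<close> is that of HOL.\<close>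
definition FDR :: "'a measure \<Rightarrow> ('a \<Rightarrow> nat set) \<Rightarrow> ('a \<Rightarrow> nat set) \<Rightarrow> real" where
  "FDR M F R = (\<integral>\<omega>. real (card (R \<omega> - F \<omega>)) / real (card (R \<omega>)) \<partial>M)"

definition FNR :: "'a measure \<Rightarrow> ('a \<Rightarrow> nat set) \<Rightarrow> ('a \<Rightarrow> nat set) \<Rightarrow> real" where
  "FNR M F R = (\<integral>\<omega>. real (card (F \<omega> - R \<omega>)) / real (card (F \<omega>)) \<partial>M)"

definition lond_FDR ::
  "(real \<Rightarrow> real) \<Rightarrow> (nat \<Rightarrow> real) \<Rightarrow> 'a measure \<Rightarrow> (nat \<Rightarrow> 'a \<Rightarrow> bool) \<Rightarrow> (nat \<Rightarrow> 'a \<Rightarrow> real) \<Rightarrow> nat \<Rightarrow> real"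
where
  "lond_FDR \<Phi> \<Lambda> M \<theta> X n =
     FDR M (false_nulls \<theta> n) (\<lambda>\<omega>. lond_rejected \<Lambda> (p_value \<Phi> X \<omega>) n)"

definition lond_FNR ::
  "(real \<Rightarrow> real) \<Rightarrow> (nat \<Rightarrow> real) \<Rightarrow> 'a measure \<Rightarrow> (nat \<Rightarrow> 'a \<Rightarrow> bool) \<Rightarrow> (nat \<Rightarrow> 'a \<Rightarrow> real) \<Rightarrow> nat \<Rightarrow> real"
where
  "lond_FNR \<Phi> \<Lambda> M \<theta> X n =
     FNR M (false_nulls \<theta> n) (\<lambda>\<omega>. lond_rejected \<Lambda> (p_value \<Phi> X \<omega>) n)"

end

theory Submission
  imports Defs
begin

text \<open>
  Up to factors \<open>n powr o(1)\<close>, every level of LOND until time \<open>n\<close> is at least \<open>n powr (-\<nu>)\<close>. At that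
  level a false null is rejected with probability about \<open>n powr (-\<rho>)\<close>, where
  \<open>\<rho> = (\<nu> powr (1/\<gamma>) - r powr (1/\<gamma>)) powr \<gamma>\<close>. By Chebyshev's inequality, about
  \<open>n powr (1 - \<beta> - \<rho>)\<close> discoveries are made already among the first \<open>n powr (1 - a)\<close> hypotheses,
  for small \<open>a > 0\<close>. The later levels are thus at least about \<open>n powr (-s)\<close> with
  \<open>s = \<nu> - 1 + \<beta> + \<rho> < r\<close>, so that their thresholds lie far below the shift and nearly all of the
  remaining false nulls are rejected. If \<open>r > \<nu>\<close>, the levels \<open>n powr (-\<nu>)\<close> already suffice.
\<close>

subsection \<open>Independence in the static mixture model\<close>

text \<open>The levels depend on earlier rejections, yet bounding the false non-discovery rate needs
  no conditioning on the past. A level is never below its weight, and D is nondecreasing in time, so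
  it suffices to count false nulls whose statistic passes a fixed threshold. These counts are sums
  of independent indicators; the feedback enters only through inclusions valid for every outcome.
  The exponent \<rho> arises because a tail of order \<open>n powr (-t)\<close> has threshold
  \<open>(\<gamma> * t * ln n) powr (1/\<gamma>)\<close>, and the shift has the same shape with r
  for t. Threshold minus shift is therefore again such a threshold, of exponent
  \<open>(t powr (1/\<gamma>) - r powr (1/\<gamma>)) powr \<gamma>\<close>. The early block has
  length about \<open>n powr (1 - a)\<close>: all its false nulls can be written off, while the
  number of discoveries it yields loses only a factor \<open>n powr (-a)\<close>. Chebyshev needs
  that number to diverge. For r \<le> \<nu> the hypothesis on r gives \<beta> + \<rho> < 1 + r -
  \<nu> \<le> 1. Tail asymptotics say nothing about the gap 0, which occurs at exponent \<nu> if r =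
  \<nu>; so an exponent t > \<nu> replaces \<nu>.\<close>

lemma distribution_functionD:
  assumes "distribution_function \<Phi>"
  shows "mono \<Phi>" "0 \<le> \<Phi> x" "\<Phi> x \<le> 1" "(\<Phi> \<longlongrightarrow> 0) at_bot" "(\<Phi> \<longlongrightarrow> 1) at_top"
    "\<Phi> \<in> borel_measurable borel"
proof -
  obtain Q where Q: "real_distribution Q" "\<Phi> = cdf Q"
    using assms by (auto simp: distribution_function_def)
  interpret real_distribution Q by (rule Q(1))
  show "mono \<Phi>" by (auto simp: Q(2) mono_def cdf_nondecreasing)
  then show "\<Phi> \<in> borel_measurable borel" by (rule borel_measurable_mono)
  show "0 \<le> \<Phi> x" "\<Phi> x \<le> 1" "(\<Phi> \<longlongrightarrow> 0) at_bot" "(\<Phi> \<longlongrightarrow> 1) at_top"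
    by (simp_all add: Q(2) cdf_nonneg cdf_bounded_prob cdf_lim_at_bot cdf_lim_at_top_prob)
qed

lemma static_mixtureD:
  assumes "static_mixture \<Phi> \<epsilon> \<mu> M \<theta> X" "i \<ge> 1"
  shows "\<theta> i \<in> measurable M (count_space UNIV)" "X i \<in> borel_measurable M"
    "measure M {\<omega> \<in> space M. \<theta> i \<omega>} = \<epsilon>"
    "measure M {\<omega> \<in> space M. \<theta> i \<omega> = b} = (if b then \<epsilon> else 1 - \<epsilon>)"
proof -
  interpret prob_space M using assms by (simp add: static_mixture_def)
  have "indep_vars (\<lambda>_. count_space UNIV) \<theta> {1..}"
    using assms by (simp add: static_mixture_def)
  then show [measurable]: "\<theta> i \<in> measurable M (count_space UNIV)"
    using assms(2) by (auto simp: indep_vars_def2)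
  show "X i \<in> borel_measurable M"
    using assms by (simp add: static_mixture_def)
  show \<epsilon>: "measure M {\<omega> \<in> space M. \<theta> i \<omega>} = \<epsilon>"
    using assms by (simp add: static_mixture_def)
  have "prob {\<omega> \<in> space M. \<not> \<theta> i \<omega>} = 1 - \<epsilon>"
    by (subst prob_neg) (simp_all add: \<epsilon>)
  with \<epsilon> show "prob {\<omega> \<in> space M. \<theta> i \<omega> = b} = (if b then \<epsilon> else 1 - \<epsilon>)"
    by (cases b) simp_all
qed

text \<open>The conditional distribution function is integrated over the event that the indicators
  on \<open>I\<close> equal \<open>b\<close>. On this event the conditional product is a constant,
  and its probability factors by independence of the indicators.\<close>

lemma static_mixture_joint_prob:
  assumes sm: "static_mixture \<Phi> \<epsilon> \<mu> M \<theta> X" and "finite I" "I \<subseteq> {1..}"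
  shows "measure M {\<omega> \<in> space M. \<forall>i\<in>I. X i \<omega> \<le> x i \<and> \<theta> i \<omega> = b i} =
    (\<Prod>i\<in>I. measure M {\<omega> \<in> space M. \<theta> i \<omega> = b i} * \<Phi> (x i - shift \<mu> (b i)))"
proof (cases "I = {}")
  case True
  interpret prob_space M using sm by (simp add: static_mixture_def)
  show ?thesis by (simp add: True prob_space)
next
  case False
  interpret prob_space M using sm by (simp add: static_mixture_def)
  let ?G = "null_algebra M \<theta>"
  have ind: "indep_vars (\<lambda>_. count_space UNIV) \<theta> {1..}"
    using sm by (simp add: static_mixture_def)
  have \<theta>[measurable]: "\<theta> i \<in> measurable M (count_space UNIV)" if "i \<ge> 1" for i
    using ind that by (auto simp: indep_vars_def2)
  have X[measurable]: "X i \<in> borel_measurable M" if "i \<ge> 1" for i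
    using sm that by (simp add: static_mixture_def)
  have sub: "subalgebra M ?G"
    unfolding subalgebra_def null_algebra_def
  proof safe
    have "(\<lambda>\<omega>. \<lambda>i\<in>{1..}. \<theta> i \<omega>) \<in> measurable M (\<Pi>\<^sub>M i\<in>{1..}. count_space UNIV)"
      by (rule measurable_restrict) auto
    then show "A \<in> sets M" if "A \<in> sets (vimage_algebra (space M) (\<lambda>\<omega>. \<lambda>i\<in>{1..}. \<theta> i \<omega>)
        (\<Pi>\<^sub>M i\<in>{1..}. count_space UNIV))" for A
      using that by (auto simp: sets_vimage_algebra2 measurable_sets space_PiM dest: measurable_space)
  qed (auto simp: space_vimage_algebra)
  interpret sigma_finite_subalgebra M ?G
    by (rule finite_measure_subalgebra_is_sigma_finite) (unfold_locales, rule sub)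
  define A where "A = {\<omega> \<in> space M. \<forall>i\<in>I. \<theta> i \<omega> = b i}"
  define E where "E = {\<omega> \<in> space M. \<forall>i\<in>I. X i \<omega> \<le> x i}"
  have E[measurable]: "E \<in> sets M"
    unfolding E_def using assms by (intro sets.sets_Collect_finite_All) auto
  \<comment> \<open>Averaging the conditional expectation over \<open>A\<close> is legitimate only
    if \<open>A\<close> belongs to the conditioning algebra; it does, as the preimage of a cylinder
    set.\<close>
  have "(\<lambda>\<omega>. \<lambda>i\<in>{1..}. \<theta> i \<omega>) -` {f \<in> space (\<Pi>\<^sub>M i\<in>{1..}. count_space UNIV). \<forall>i\<in>I. f i = b i}
      \<inter> space M = A"
    using assms by (auto simp: A_def space_PiM)
  moreover
  have "{f \<in> space (\<Pi>\<^sub>M i\<in>{1..}. count_space UNIV). \<forall>i\<in>I. f i = b i}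
      \<in> sets (\<Pi>\<^sub>M i\<in>{1::nat..}. count_space (UNIV :: bool set))"
    using assms by (intro sets.sets_Collect_finite_All) auto
  from in_vimage_algebra[OF this, of "\<lambda>\<omega>. \<lambda>i\<in>{1..}. \<theta> i \<omega>" "space M"]
  have "(\<lambda>\<omega>. \<lambda>i\<in>{1..}. \<theta> i \<omega>) -` {f \<in> space (\<Pi>\<^sub>M i\<in>{1..}. count_space UNIV). \<forall>i\<in>I. f i = b i}
      \<inter> space M \<in> sets ?G"
    by (simp only: null_algebra_def)
  ultimately have A: "A \<in> sets ?G"
    by (simp only:)
  then have A'[measurable]: "A \<in> sets M"
    using sub by (auto simp: subalgebra_def)
  have ce: "AE \<omega> in M. real_cond_exp M ?G (indicator E) \<omega> =
      (\<Prod>i\<in>I. \<Phi> (x i - shift \<mu> (\<theta> i \<omega>)))"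
    using sm assms unfolding E_def static_mixture_def by blast
  have "prob {\<omega> \<in> space M. \<forall>i\<in>I. X i \<omega> \<le> x i \<and> \<theta> i \<omega> = b i} = prob (A \<inter> E)"
    by (rule arg_cong[where f = prob]) (auto simp: A_def E_def)
  also have "\<dots> = (\<integral>\<omega>\<in>A. indicator E \<omega> \<partial>M)"
    by (simp add: set_lebesgue_integral_def flip: indicator_inter_arith)
  also have "\<dots> = (\<integral>\<omega>\<in>A. real_cond_exp M ?G (indicator E) \<omega> \<partial>M)"
    proof (rule real_cond_exp_intA[OF _ A])
    show "integrable M (indicator E :: _ \<Rightarrow> real)"
      by (rule integrable_real_indicator[OF E]) (simp add: emeasure_eq_measure)
  qed
  also have "\<dots> = (\<integral>\<omega>. indicator A \<omega> * (\<Prod>i\<in>I. \<Phi> (x i - shift \<mu> (b i))) \<partial>M)"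
    unfolding set_lebesgue_integral_def
  proof (rule integral_cong_AE)
    have "real_cond_exp M ?G (indicator E) \<in> borel_measurable M"
      by (rule borel_measurable_cond_exp2)
    then show "(\<lambda>\<omega>. indicator A \<omega> *\<^sub>R real_cond_exp M ?G (indicator E) \<omega>) \<in> borel_measurable M"
      by measurable
    show "AE \<omega> in M. indicator A \<omega> *\<^sub>R real_cond_exp M ?G (indicator E) \<omega> =
        indicator A \<omega> * (\<Prod>i\<in>I. \<Phi> (x i - shift \<mu> (b i)))"
      using ce by eventually_elim (auto simp: A_def indicator_def intro!: prod.cong)
  qed simp
  also have "\<dots> = prob A * (\<Prod>i\<in>I. \<Phi> (x i - shift \<mu> (b i)))"
    by simp
  also have "prob A = (\<Prod>i\<in>I. prob {\<omega> \<in> space M. \<theta> i \<omega> = b i})"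
  proof -
    have "indep_events (\<lambda>i. {\<omega> \<in> space M. \<theta> i \<omega> = b i}) {1..}"
      by (rule indep_eventsI_indep_vars[OF ind]) auto
    then have "prob (\<Inter>i\<in>I. {\<omega> \<in> space M. \<theta> i \<omega> = b i}) =
        (\<Prod>i\<in>I. prob {\<omega> \<in> space M. \<theta> i \<omega> = b i})"
      using assms False by (auto simp: indep_events_def)
    moreover have "(\<Inter>i\<in>I. {\<omega> \<in> space M. \<theta> i \<omega> = b i}) = A"
      using False by (auto simp: A_def)
    ultimately show ?thesis by simp
  qed
  finally show ?thesis by (simp add: prod.distrib)
qed

lemma static_mixture_prob_le:
  assumes "static_mixture \<Phi> \<epsilon> \<mu> M \<theta> X" "i \<ge> 1"
  shows "measure M {\<omega> \<in> space M. X i \<omega> \<le> x \<and> \<theta> i \<omega> = b} =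
    (if b then \<epsilon> else 1 - \<epsilon>) * \<Phi> (x - shift \<mu> b)"
  using static_mixture_joint_prob[OF assms(1), of "{i}" "\<lambda>_. x" "\<lambda>_. b"]
    static_mixtureD(4)[OF assms] assms(2) by simp

lemma static_mixture_prob_gt:
  assumes sm: "static_mixture \<Phi> \<epsilon> \<mu> M \<theta> X" and i: "i \<ge> 1"
  shows "measure M {\<omega> \<in> space M. X i \<omega> > x \<and> \<theta> i \<omega> = b} =
    (if b then \<epsilon> else 1 - \<epsilon>) * (1 - \<Phi> (x - shift \<mu> b))"
proof -
  interpret prob_space M using sm by (simp add: static_mixture_def)
  note [measurable] = static_mixtureD[OF assms]
  have "prob {\<omega> \<in> space M. \<theta> i \<omega> = b} =
      prob {\<omega> \<in> space M. X i \<omega> > x \<and> \<theta> i \<omega> = b} + prob {\<omega> \<in> space M. X i \<omega> \<le> x \<and> \<theta> i \<omega> = b}"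
    by (subst finite_measure_Union[symmetric]) (auto intro!: arg_cong[where f = prob])
  then show ?thesis
    by (simp add: static_mixture_prob_le[OF assms] static_mixtureD(4)[OF assms] algebra_simps)
qed

text \<open>The model speaks of conditional independence; everything later uses unconditional
  independence of the pairs. The events \<open>X i \<le> x\<close> with
  \<open>\<theta> i = b\<close> satisfy the product formula, and together with the empty set they
  form an intersection-stable generator.\<close>

lemma static_mixture_indep_vars:
  assumes sm: "static_mixture \<Phi> \<epsilon> \<mu> M \<theta> X"
  shows "prob_space.indep_vars M (\<lambda>_. count_space UNIV \<Otimes>\<^sub>M borel) (\<lambda>i \<omega>. (\<theta> i \<omega>, X i \<omega>)) {1..}"
proof -
  interpret prob_space M using sm by (simp add: static_mixture_def)
  note meas = static_mixtureD(1,2)[OF sm]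
  \<comment> \<open>The empty set is the intersection of two generators with different values of
    \<open>\<theta> i\<close>.\<close>
  define F where "F i = insert {} {{\<omega> \<in> space M. X i \<omega> \<le> x \<and> \<theta> i \<omega> = b} | x b. True}" for i
  have FM: "F i \<subseteq> events" if "i \<ge> 1" for i
    using meas[OF that] by (auto simp: F_def)
  have "indep_sets F {1..}"
  proof (rule indep_setsI)
    fix A J assume J: "J \<noteq> {}" "J \<subseteq> {1..}" "finite J" and A: "\<forall>j\<in>J. A j \<in> F j"
    show "prob (\<Inter>j\<in>J. A j) = (\<Prod>j\<in>J. prob (A j))"
    proof (cases "\<exists>j\<in>J. A j = {}")
      case True
      then have "(\<Inter>j\<in>J. A j) = {}" by auto
      with True J show ?thesis by (metis measure_empty prod_zero)
    next
      case False
      then have "\<forall>j\<in>J. \<exists>x b. A j = {\<omega> \<in> space M. X j \<omega> \<le> x \<and> \<theta> j \<omega> = b}"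
        using A by (auto simp: F_def)
      then obtain x b where *: "\<And>j. j \<in> J \<Longrightarrow> A j = {\<omega> \<in> space M. X j \<omega> \<le> x j \<and> \<theta> j \<omega> = b j}"
        by metis
      then have "(\<Inter>j\<in>J. A j) = {\<omega> \<in> space M. \<forall>j\<in>J. X j \<omega> \<le> x j \<and> \<theta> j \<omega> = b j}"
        using J by auto
      then have "prob (\<Inter>j\<in>J. A j) = (\<Prod>j\<in>J. prob {\<omega> \<in> space M. \<theta> j \<omega> = b j} * \<Phi> (x j - shift \<mu> (b j)))"
        using static_mixture_joint_prob[OF sm J(3,2)] by simp
      also have "\<dots> = (\<Prod>j\<in>J. prob (A j))"
        using J by (intro prod.cong refl)
          (auto simp: * static_mixture_prob_le[OF sm] static_mixtureD(4)[OF sm])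
      finally show ?thesis .
    qed
  qed (use FM in auto)
  then have ind: "indep_sets (\<lambda>i. sigma_sets (space M) (F i)) {1..}"
  proof (rule indep_sets_sigma)
    fix i :: nat
    have *: "{\<omega> \<in> space M. X i \<omega> \<le> x \<and> \<theta> i \<omega> = b} \<inter> {\<omega> \<in> space M. X i \<omega> \<le> y \<and> \<theta> i \<omega> = c} \<in> F i" for x b y c
    proof (cases "b = c")
      case True
      then have "{\<omega> \<in> space M. X i \<omega> \<le> x \<and> \<theta> i \<omega> = b} \<inter> {\<omega> \<in> space M. X i \<omega> \<le> y \<and> \<theta> i \<omega> = c}
          = {\<omega> \<in> space M. X i \<omega> \<le> min x y \<and> \<theta> i \<omega> = b}" by auto
      then show ?thesis unfolding F_def by blast
    qed (auto simp: F_def)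
    show "Int_stable (F i)"
      unfolding Int_stable_def
    proof (intro ballI)
      fix A B assume AB: "A \<in> F i" "B \<in> F i"
      have "{} \<in> F i" by (simp add: F_def)
      moreover have "A = {} \<or> (\<exists>x b. A = {\<omega> \<in> space M. X i \<omega> \<le> x \<and> \<theta> i \<omega> = b})"
        using AB(1) unfolding F_def by simp
      moreover have "B = {} \<or> (\<exists>x b. B = {\<omega> \<in> space M. X i \<omega> \<le> x \<and> \<theta> i \<omega> = b})"
        using AB(2) unfolding F_def by simp
      ultimately show "A \<inter> B \<in> F i"
        using * by (elim disjE exE) (simp_all only: Int_empty_left Int_empty_right)
    qed
  qed
  show ?thesis
    unfolding indep_vars_def2
  proof (intro conjI ballI)
    show "(\<lambda>\<omega>. (\<theta> i \<omega>, X i \<omega>)) \<in> measurable M (count_space UNIV \<Otimes>\<^sub>M borel)" if "i \<in> {1..}" for i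
      using that meas by (intro measurable_Pair) auto
    show "indep_sets (\<lambda>i. {(\<lambda>\<omega>. (\<theta> i \<omega>, X i \<omega>)) -` A \<inter> space M |A.
        A \<in> sets (count_space UNIV \<Otimes>\<^sub>M borel)}) {1..}"
    proof (rule indep_sets_mono_sets[OF ind])
      fix i :: nat assume "i \<in> {1..}"
      then have FP: "F i \<subseteq> Pow (space M)" using FM[of i] sets.sets_into_space by auto
      define N where "N = sigma (space M) (F i)"
      have sp: "space N = space M" and se: "sets N = sigma_sets (space M) (F i)"
        using FP by (simp_all add: N_def)
      have Fb: "{\<omega> \<in> space M. X i \<omega> \<le> x \<and> \<theta> i \<omega> = b} \<in> sets N" for x b
        unfolding se by (rule sigma_sets.Basic) (auto simp: F_def)
      have 1: "X i \<in> borel_measurable N"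
        unfolding borel_measurable_iff_le
      proof
        fix x
        have "{\<omega> \<in> space N. X i \<omega> \<le> x} =
          {\<omega> \<in> space M. X i \<omega> \<le> x \<and> \<theta> i \<omega> = True} \<union> {\<omega> \<in> space M. X i \<omega> \<le> x \<and> \<theta> i \<omega> = False}"
          by (auto simp: sp)
        also have "\<dots> \<in> sets N" by (intro sets.Un Fb)
        finally show "{\<omega> \<in> space N. X i \<omega> \<le> x} \<in> sets N" .
      qed
      \<comment> \<open>The indicator alone is not a generator; it is recovered by letting the bound
        on \<open>X i\<close> run through the naturals.\<close>
      have "{\<omega> \<in> space N. \<theta> i \<omega>} = (\<Union>k::nat. {\<omega> \<in> space M. X i \<omega> \<le> real k \<and> \<theta> i \<omega> = True})"
        using real_arch_simple by (auto simp: sp)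
      also have "\<dots> \<in> sets N" by (intro sets.countable_UN image_subsetI Fb)
      finally have 2: "\<theta> i \<in> measurable N (count_space UNIV)"
        by (simp add: pred_def)
      have 3: "(\<lambda>\<omega>. (\<theta> i \<omega>, X i \<omega>)) \<in> measurable N (count_space UNIV \<Otimes>\<^sub>M borel)"
        by (intro measurable_Pair 1 2)
      show "{(\<lambda>\<omega>. (\<theta> i \<omega>, X i \<omega>)) -` A \<inter> space M |A. A \<in> sets (count_space UNIV \<Otimes>\<^sub>M borel)}
          \<subseteq> sigma_sets (space M) (F i)"
        using measurable_sets[OF 3] by (auto simp: sp se)
    qed
  qed
qed

subsection \<open>Control of the false discovery rate\<close>

text \<open>Where \<Phi> is flat, \<open>\<Phi> x = 1 - t\<close> would not turn a P-value at most
  \<open>t\<close> into \<open>X i > x\<close>, and for \<open>t = 0\<close> no such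
  \<open>x\<close> need exist. With \<open>\<Phi> x = 1 - s\<close> for some \<open>s\<close>
  strictly between \<open>t\<close> and 1, which continuity provides, monotonicity alone gives
  \<open>X i > x\<close>; then \<open>s\<close> decreases to \<open>t\<close>.\<close>

lemma p_value_superuniform:
  assumes df: "distribution_function \<Phi>" and cont: "continuous_on UNIV \<Phi>"
    and sm: "static_mixture \<Phi> \<epsilon> \<mu> M \<theta> X" and i: "i \<ge> 1" and \<epsilon>: "0 \<le> \<epsilon>" "\<epsilon> \<le> 1" and t: "t \<ge> 0"
  shows "measure M {\<omega> \<in> space M. \<not> \<theta> i \<omega> \<and> p_value \<Phi> X \<omega> i \<le> t} \<le> t"
proof (cases "t < 1")
  case False
  interpret prob_space M using sm by (simp add: static_mixture_def)
  show ?thesis using False prob_le_1 by (smt (verit))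
next
  case True
  interpret prob_space M using sm by (simp add: static_mixture_def)
  note [measurable] = static_mixtureD[OF sm i] distribution_functionD(6)[OF df]
  note D = distribution_functionD[OF df]
  let ?E = "{\<omega> \<in> space M. \<not> \<theta> i \<omega> \<and> p_value \<Phi> X \<omega> i \<le> t}"
  have "prob ?E \<le> s" if s: "t < s" "s < 1" for s
  proof -
    obtain x where x: "\<Phi> x = 1 - s"
    proof -
      have "eventually (\<lambda>x. \<Phi> x < 1 - s) at_bot" "eventually (\<lambda>x. \<Phi> x > 1 - s) at_top"
        using s t by (auto intro: order_tendstoD D)
      then obtain a b where "\<Phi> a < 1 - s" "\<Phi> b > 1 - s"
        by (meson eventually_at_bot_linorder eventually_at_top_linorder order_refl)
      moreover from this have "a \<le> b"
        using monoD[OF D(1), of b a] by linarith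
      ultimately have "\<exists>x\<ge>a. x \<le> b \<and> \<Phi> x = 1 - s"
        using cont by (intro IVT') (auto intro: continuous_on_subset)
      then show ?thesis using that by blast
    qed
    have "prob ?E \<le> prob {\<omega> \<in> space M. X i \<omega> > x \<and> \<theta> i \<omega> = False}"
    proof (rule finite_measure_mono)
      show "?E \<subseteq> {\<omega> \<in> space M. X i \<omega> > x \<and> \<theta> i \<omega> = False}"
        using s(1) x monoD[OF D(1), of "X i _" x] by (fastforce simp: p_value_def not_less[symmetric])
    qed measurable
    also have "\<dots> = (1 - \<epsilon>) * s"
      unfolding static_mixture_prob_gt[OF sm i] by (simp add: shift_def x)
    also have "\<dots> \<le> s"
      using \<epsilon> s t by (simp add: mult_left_le_one_le)
    finally show ?thesis .
  qed
  then show ?thesis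
    using dense_ge_bounded[OF True] by blast
qed

section \<open>The number of discoveries as a function of past P-values\<close>

lemma lond_discoveries_cong:
  assumes "\<And>i. 1 \<le> i \<Longrightarrow> i \<le> k \<Longrightarrow> p i = p' i"
  shows "lond_discoveries \<Lambda> p k = lond_discoveries \<Lambda> p' k"
  using assms by (induction k) auto

lemma lond_discoveries_le: "lond_discoveries \<Lambda> p k \<le> k"
  by (induction k) auto

lemma measurable_lond_discoveries:
  assumes "\<And>i. 1 \<le> i \<Longrightarrow> i \<le> k \<Longrightarrow> (\<lambda>\<omega>. p \<omega> i) \<in> borel_measurable N"
  shows "(\<lambda>\<omega>. lond_discoveries \<Lambda> (p \<omega>) k) \<in> measurable N (count_space UNIV)"
  using assms
proof (induction k)
  case (Suc k)
  have [measurable]: "(\<lambda>\<omega>. lond_discoveries \<Lambda> (p \<omega>) k) \<in> measurable N (count_space UNIV)"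
    using Suc by simp
  have [measurable]: "(\<lambda>\<omega>. p \<omega> (Suc k)) \<in> borel_measurable N"
    using Suc by simp
  show ?case by simp
qed simp

text \<open>Fixing the value \<open>k\<close> of D(i - 1) turns the random level into a constant
  \<open>t\<close>. D(i - 1) is a function of the pairs with index below \<open>i\<close>, hence
  independent of the pair at \<open>i\<close>, and superuniformity supplies the factor
  \<open>t\<close>.\<close>

lemma prob_null_rejected_given_discoveries_le:
  assumes df: "distribution_function \<Phi>" and cont: "continuous_on UNIV \<Phi>"
    and sm: "static_mixture \<Phi> \<epsilon> \<mu> M \<theta> X" and i: "i \<ge> 1" and \<epsilon>: "0 \<le> \<epsilon>" "\<epsilon> \<le> 1" and t: "t \<ge> 0"
  shows "measure M {\<omega> \<in> space M. lond_discoveries \<Lambda> (p_value \<Phi> X \<omega>) (i - 1) = k \<and>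
      \<not> \<theta> i \<omega> \<and> p_value \<Phi> X \<omega> i \<le> t} \<le>
    t * measure M {\<omega> \<in> space M. lond_discoveries \<Lambda> (p_value \<Phi> X \<omega>) (i - 1) = k}"
proof -
  interpret prob_space M using sm by (simp add: static_mixture_def)
  note [measurable] = distribution_functionD(6)[OF df]
  let ?N = "count_space UNIV \<Otimes>\<^sub>M borel :: (bool \<times> real) measure"
  let ?D = "\<lambda>f. lond_discoveries \<Lambda> (\<lambda>j. 1 - \<Phi> (snd (f j))) (i - 1)"
  \<comment> \<open>The event is coded as 0 or 1 in the naturals because \<open>indep_var\<close>
    takes two variables of the same type, and \<open>?D\<close> is a natural number.\<close>
  let ?S = "\<lambda>f. if \<not> fst (f i) \<and> 1 - \<Phi> (snd (f i)) \<le> t then 1 else 0 :: nat"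
  have "indep_var (Pi\<^sub>M {1..<i} (\<lambda>_. ?N)) (\<lambda>\<omega>. restrict (\<lambda>j. (\<theta> j \<omega>, X j \<omega>)) {1..<i})
      (Pi\<^sub>M {i} (\<lambda>_. ?N)) (\<lambda>\<omega>. restrict (\<lambda>j. (\<theta> j \<omega>, X j \<omega>)) {i})"
    using i by (intro indep_var_restrict[OF static_mixture_indep_vars[OF sm]]) auto
  moreover have D: "?D \<in> measurable (Pi\<^sub>M {1..<i} (\<lambda>_. ?N)) (count_space UNIV)"
  proof (rule measurable_lond_discoveries)
    fix j assume "1 \<le> j" "j \<le> i - 1"
    then have [measurable]: "(\<lambda>f. f j) \<in> measurable (Pi\<^sub>M {1..<i} (\<lambda>_. ?N)) ?N"
      using i by (intro measurable_component_singleton) auto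
    show "(\<lambda>f. 1 - \<Phi> (snd (f j))) \<in> borel_measurable (Pi\<^sub>M {1..<i} (\<lambda>_. ?N))"
      by measurable
  qed
  moreover
  have [measurable]: "(\<lambda>f. f i) \<in> measurable (Pi\<^sub>M {i} (\<lambda>_. ?N)) ?N"
    by (intro measurable_component_singleton) auto
  have "?S \<in> measurable (Pi\<^sub>M {i} (\<lambda>_. ?N)) (count_space UNIV)"
    by measurable
  ultimately have ind: "indep_var
      (count_space UNIV) (?D \<circ> (\<lambda>\<omega>. restrict (\<lambda>j. (\<theta> j \<omega>, X j \<omega>)) {1..<i}))
      (count_space UNIV) (?S \<circ> (\<lambda>\<omega>. restrict (\<lambda>j. (\<theta> j \<omega>, X j \<omega>)) {i}))"
    by (rule indep_var_compose)
  have "?D (restrict (\<lambda>j. (\<theta> j \<omega>, X j \<omega>)) {1..<i}) = lond_discoveries \<Lambda> (p_value \<Phi> X \<omega>) (i - 1)" for \<omega>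
    using i by (intro lond_discoveries_cong) (auto simp: p_value_def)
  then have 1: "(?D \<circ> (\<lambda>\<omega>. restrict (\<lambda>j. (\<theta> j \<omega>, X j \<omega>)) {1..<i})) \<omega> \<in> {k} \<longleftrightarrow>
      lond_discoveries \<Lambda> (p_value \<Phi> X \<omega>) (i - 1) = k" for \<omega>
    by (simp only: o_apply singleton_iff)
  have 2: "(?S \<circ> (\<lambda>\<omega>. restrict (\<lambda>j. (\<theta> j \<omega>, X j \<omega>)) {i})) \<omega> \<in> {1} \<longleftrightarrow>
      \<not> \<theta> i \<omega> \<and> p_value \<Phi> X \<omega> i \<le> t" for \<omega>
    by (simp add: p_value_def)
  have "prob {\<omega> \<in> space M. lond_discoveries \<Lambda> (p_value \<Phi> X \<omega>) (i - 1) = k \<and>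
      \<not> \<theta> i \<omega> \<and> p_value \<Phi> X \<omega> i \<le> t} =
    prob {\<omega> \<in> space M. lond_discoveries \<Lambda> (p_value \<Phi> X \<omega>) (i - 1) = k} *
    prob {\<omega> \<in> space M. \<not> \<theta> i \<omega> \<and> p_value \<Phi> X \<omega> i \<le> t}"
    using prob_indep_random_variable[OF ind, of "{k}" "{1}"] unfolding 1 2 by simp
  also have "\<dots> \<le> prob {\<omega> \<in> space M. lond_discoveries \<Lambda> (p_value \<Phi> X \<omega>) (i - 1) = k} * t"
    using p_value_superuniform[OF df cont sm i \<epsilon> t] by (intro mult_left_mono) auto
  finally show ?thesis by (simp add: mult.commute)
qed

lemma lond_discoveries_mono:
  "k \<le> l \<Longrightarrow> lond_discoveries \<Lambda> p k \<le> lond_discoveries \<Lambda> p l"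
  by (rule lift_Suc_mono_le) simp

text \<open>
  A rejection at time \<open>i\<close> forces \<open>D(n) \<ge> D(i - 1) + 1\<close>, and the latter factor cancels the one in
  the level of LOND, because \<open>P\<^sub>i\<close> is independent of \<open>D(i - 1)\<close>.
\<close>
lemma lond_FDR_le_sum:
  assumes df: "distribution_function \<Phi>" and cont: "continuous_on UNIV \<Phi>"
    and sm: "static_mixture \<Phi> \<epsilon> \<mu> M \<theta> X" and \<epsilon>: "0 \<le> \<epsilon>" "\<epsilon> \<le> 1"
    and \<Lambda>: "\<And>i. i \<ge> 1 \<Longrightarrow> \<Lambda> i \<ge> 0"
  shows "lond_FDR \<Phi> \<Lambda> M \<theta> X n \<le> (\<Sum>i=1..n. \<Lambda> i)"
proof -
  interpret prob_space M using sm by (simp add: static_mixture_def)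
  note [measurable] = distribution_functionD(6)[OF df]
  define D where "D k \<omega> = lond_discoveries \<Lambda> (p_value \<Phi> X \<omega>) k" for k \<omega>
  define B where "B i k = {\<omega> \<in> space M. D (i - 1) \<omega> = k \<and> \<not> \<theta> i \<omega> \<and>
    p_value \<Phi> X \<omega> i \<le> \<Lambda> i * (real k + 1)}" for i k
  define C where "C i k = {\<omega> \<in> space M. D (i - 1) \<omega> = k}" for i k
  have p[measurable]: "(\<lambda>\<omega>. p_value \<Phi> X \<omega> i) \<in> borel_measurable M" if "i \<ge> 1" for i
  proof -
    note [measurable] = static_mixtureD(2)[OF sm that]
    show ?thesis unfolding p_value_def by measurable
  qed
  have D[measurable]: "D k \<in> measurable M (count_space UNIV)" for k
    unfolding D_def using p by (intro measurable_lond_discoveries) auto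
  have B[measurable]: "B i k \<in> sets M" if "i \<ge> 1" for i k
  proof -
    note [measurable] = static_mixtureD(1)[OF sm that] p[OF that]
    show ?thesis unfolding B_def by measurable
  qed
  have C[measurable]: "C i k \<in> sets M" for i k
    unfolding C_def by measurable
  \<comment> \<open>The false discovery proportion is split by the time \<open>i\<close> of a false
    rejection and the value \<open>k\<close> of D(i - 1). The range \<open>k \<le> i\<close> is
    ample, as D(i - 1) \<le> i - 1.\<close>
  let ?g = "\<lambda>\<omega>. \<Sum>i=1..n. \<Sum>k\<le>i. indicator (B i k) \<omega> / (real k + 1) :: real"
  have "lond_FDR \<Phi> \<Lambda> M \<theta> X n \<le> (\<integral>\<omega>. ?g \<omega> \<partial>M)"
    unfolding lond_FDR_def FDR_def
  proof (rule integral_mono')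
    show "integrable M ?g"
      using B by (intro Bochner_Integration.integrable_sum integrable_divide_zero integrable_real_indicator)
        (auto simp: emeasure_eq_measure)
    fix \<omega> assume \<omega>: "\<omega> \<in> space M"
    let ?R = "lond_rejected \<Lambda> (p_value \<Phi> X \<omega>) n"
    let ?F = "?R - false_nulls \<theta> n \<omega>"
    have F: "?F \<subseteq> {1..n}" by (auto simp: lond_rejected_def)
    then have "finite ?F" by (rule finite_subset) simp
    then have "real (card ?F) / real (card ?R) = (\<Sum>i\<in>?F. 1 / real (card ?R))"
      by simp
    also have "\<dots> \<le> (\<Sum>i\<in>?F. \<Sum>k\<le>i. indicator (B i k) \<omega> / (real k + 1))"
    proof (rule sum_mono)
      fix i assume i: "i \<in> ?F"
      then have i': "1 \<le> i" "i \<le> n" "\<not> \<theta> i \<omega>"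
        "p_value \<Phi> X \<omega> i \<le> \<Lambda> i * (real (D (i - 1) \<omega>) + 1)"
        by (auto simp: lond_rejected_def false_nulls_def lond_level_def D_def)
      have "D (i - 1) \<omega> + 1 = D i \<omega>"
        using i' by (cases i) (auto simp: D_def)
      also have "\<dots> \<le> D n \<omega>"
        unfolding D_def using i' by (intro lond_discoveries_mono) simp
      also have "\<dots> = card ?R"
        by (simp add: D_def lond_discoveries_eq_card)
      finally have "real (D (i - 1) \<omega>) + 1 \<le> real (card ?R)"
        by linarith
      \<comment> \<open>Of the inner sum only the term at the actual value of D(i - 1) is
        needed.\<close>
      then have "1 / real (card ?R) \<le> indicator (B i (D (i - 1) \<omega>)) \<omega> / (real (D (i - 1) \<omega>) + 1)"
        using i' \<omega> by (simp add: B_def frac_le)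
      also have "\<dots> \<le> (\<Sum>k\<le>i. indicator (B i k) \<omega> / (real k + 1))"
      proof (rule member_le_sum)
        have "D (i - 1) \<omega> \<le> i - 1" unfolding D_def by (rule lond_discoveries_le)
        then show "D (i - 1) \<omega> \<in> {..i}" by simp
      qed simp_all
      finally show "1 / real (card ?R) \<le> (\<Sum>k\<le>i. indicator (B i k) \<omega> / (real k + 1))" .
    qed
    also have "\<dots> \<le> ?g \<omega>"
      using F by (intro sum_mono2) (auto intro!: sum_nonneg)
    finally show "real (card ?F) / real (card ?R) \<le> ?g \<omega>" .
  qed (auto intro!: sum_nonneg)
  also have "\<dots> = (\<Sum>i=1..n. \<Sum>k\<le>i. prob (B i k) / (real k + 1))"
    using B by (subst Bochner_Integration.integral_sum;
      (intro sum.cong refl Bochner_Integration.integrable_sum integrable_divide_zero integrable_real_indicator)?)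
      (auto simp: emeasure_eq_measure)
  also have "\<dots> \<le> (\<Sum>i=1..n. \<Sum>k\<le>i. \<Lambda> i * prob (C i k))"
  proof (intro sum_mono)
    fix i k assume i: "i \<in> {1..n}"
    have "prob (B i k) \<le> \<Lambda> i * (real k + 1) * prob (C i k)"
      unfolding B_def C_def D_def
      using i \<Lambda> by (intro prob_null_rejected_given_discoveries_le[OF df cont sm _ \<epsilon>]) auto
    then show "prob (B i k) / (real k + 1) \<le> \<Lambda> i * prob (C i k)"
      by (simp add: divide_le_eq algebra_simps)
  qed
  also have "\<dots> = (\<Sum>i=1..n. \<Lambda> i * (\<Sum>k\<le>i. prob (C i k)))"
    by (simp add: sum_distrib_left)
  also have "\<dots> \<le> (\<Sum>i=1..n. \<Lambda> i)"
  proof (rule sum_mono)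
    fix i assume i: "i \<in> {1..n}"
    \<comment> \<open>The events \<open>C i k\<close> are disjoint in \<open>k\<close>, so their
      probabilities add up to at most 1.\<close>
    have "(\<Sum>k\<le>i. prob (C i k)) = prob (\<Union>k\<le>i. C i k)"
      by (rule finite_measure_finite_Union[symmetric]) (auto simp: disjoint_family_on_def C_def)
    then show "\<Lambda> i * (\<Sum>k\<le>i. prob (C i k)) \<le> \<Lambda> i"
      using \<Lambda>[of i] i by (simp add: mult_left_le)
  qed
  finally show ?thesis .
qed

subsection \<open>A bound on the false non-discovery rate\<close>

text \<open>Chebyshev with deviation m/2 from the mean m: covariances vanish and the variance is at
  most m, which gives m / (m/2)^2 = 4/m.\<close>

lemma (in prob_space) prob_count_less_half_mean:
  assumes fin: "finite I" and ind: "indep_events B I" and p: "\<And>i. i \<in> I \<Longrightarrow> prob (B i) = p"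
  shows "prob {\<omega> \<in> space M. real (card {i\<in>I. \<omega> \<in> B i}) < real (card I) * p / 2} \<le> 4 / (real (card I) * p)"
proof (cases "real (card I) * p > 0")
  \<comment> \<open>With mean 0 the right-hand side is 4/0 = 0, and the event is empty. This
    degenerate case is used later with an empty early block.\<close>
  case False
  then have "{\<omega> \<in> space M. real (card {i\<in>I. \<omega> \<in> B i}) < real (card I) * p / 2} = {}"
    by (auto simp: not_less intro: order_trans[of _ 0])
  moreover have "real (card I) * p \<ge> 0"
    using measure_nonneg p by (metis card.empty ex_in_conv mult_nonneg_nonneg mult_zero_left of_nat_0 of_nat_0_le_iff order_refl)
  ultimately show ?thesis by (simp only: measure_empty) simp
next
  case True
  define m where "m = real (card I) * p"
  define N where "N \<omega> = (\<Sum>i\<in>I. indicator (B i) \<omega> :: real)" for \<omega>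
  have B[measurable]: "B i \<in> events" if "i \<in> I" for i
    using ind that by (auto simp: indep_events_def)
  have N: "real (card {i\<in>I. \<omega> \<in> B i}) = N \<omega>" for \<omega>
    using fin by (simp add: N_def indicator_def sum.If_cases Int_def)
  have [measurable]: "N \<in> borel_measurable M"
    unfolding N_def using B by measurable
  have intB: "integrable M (indicator (B i) :: _ \<Rightarrow> real)" if "i \<in> I" for i
    using B[OF that] by (intro integrable_real_indicator) (auto simp: emeasure_eq_measure)
  have intBB: "integrable M (indicator (B i \<inter> B j) :: _ \<Rightarrow> real)" if "i \<in> I" "j \<in> I" for i j
    using B[OF that(1)] B[OF that(2)]
    by (intro integrable_real_indicator) (auto simp: emeasure_eq_measure)
  have expand: "(indicator (B i) \<omega> - p) * (indicator (B j) \<omega> - p) =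
      indicator (B i \<inter> B j) \<omega> - p * indicator (B i) \<omega> - p * indicator (B j) \<omega> + p * p" for i j \<omega>
    by (simp add: indicator_def algebra_simps)
  have int: "integrable M (\<lambda>\<omega>. (indicator (B i) \<omega> - p) * (indicator (B j) \<omega> - p))"
    if "i \<in> I" "j \<in> I" for i j
    unfolding expand using intB intBB that
    by (intro Bochner_Integration.integrable_add Bochner_Integration.integrable_diff
        integrable_mult_right) auto
  have cov: "(\<integral>\<omega>. (indicator (B i) \<omega> - p) * (indicator (B j) \<omega> - p) \<partial>M) \<le> (if i = j then p else 0)"
    if ij: "i \<in> I" "j \<in> I" for i j
  proof -
    have "(\<integral>\<omega>. (indicator (B i) \<omega> - p) * (indicator (B j) \<omega> - p) \<partial>M) = prob (B i \<inter> B j) - p * p"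
      unfolding expand using intB intBB ij p by (simp add: prob_space B sets.Int)
    also have "\<dots> \<le> (if i = j then p else 0)"
    proof (cases "i = j")
      case False
      have "\<forall>J\<subseteq>I. J \<noteq> {} \<longrightarrow> finite J \<longrightarrow> prob (\<Inter>k\<in>J. B k) = (\<Prod>k\<in>J. prob (B k))"
        using ind by (simp add: indep_events_def)
      from this[rule_format, of "{i, j}"] show ?thesis using False ij p by simp
    qed (use p ij in simp)
    finally show ?thesis .
  qed
  have sq: "(N \<omega> - m)\<^sup>2 = (\<Sum>i\<in>I. \<Sum>j\<in>I. (indicator (B i) \<omega> - p) * (indicator (B j) \<omega> - p))" for \<omega>
  proof -
    have "N \<omega> - m = (\<Sum>i\<in>I. indicator (B i) \<omega> - p)"
      by (simp add: N_def m_def sum_subtractf)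
    then show ?thesis by (simp only: power2_eq_square sum_product)
  qed
  have int2: "integrable M (\<lambda>\<omega>. (N \<omega> - m)\<^sup>2)"
    unfolding sq using int by (intro Bochner_Integration.integrable_sum)
  have "(\<integral>\<omega>. (N \<omega> - m)\<^sup>2 \<partial>M) =
      (\<Sum>i\<in>I. \<Sum>j\<in>I. \<integral>\<omega>. (indicator (B i) \<omega> - p) * (indicator (B j) \<omega> - p) \<partial>M)"
    unfolding sq using int by (simp add: Bochner_Integration.integral_sum)
  also have "\<dots> \<le> (\<Sum>i\<in>I. \<Sum>j\<in>I. if i = j then p else 0)"
    using cov by (intro sum_mono)
  also have "\<dots> = m"
    using fin by (simp add: m_def)
  finally have var: "(\<integral>\<omega>. (N \<omega> - m)\<^sup>2 \<partial>M) \<le> m" .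
  have "prob {\<omega> \<in> space M. N \<omega> < m / 2} = (\<integral>\<omega>. indicator {\<omega> \<in> space M. N \<omega> < m / 2} \<omega> \<partial>M)"
    by simp
  also have "\<dots> \<le> (\<integral>\<omega>. 4 / m\<^sup>2 * (N \<omega> - m)\<^sup>2 \<partial>M)"
  proof (rule integral_mono')
    show "integrable M (\<lambda>\<omega>. 4 / m\<^sup>2 * (N \<omega> - m)\<^sup>2)"
      using int2 by simp
    fix \<omega>
    have "1 \<le> 4 / m\<^sup>2 * (N \<omega> - m)\<^sup>2" if "N \<omega> < m / 2"
    proof -
      have "(m / 2)\<^sup>2 \<le> (m - N \<omega>)\<^sup>2"
        using that True unfolding m_def[symmetric] by (intro power_mono) linarith+
      then show ?thesis
        using True unfolding m_def[symmetric] by (simp add: field_simps power2_commute[of "N \<omega>"])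
    qed
    then show "indicator {\<omega> \<in> space M. N \<omega> < m / 2} \<omega> \<le> 4 / m\<^sup>2 * (N \<omega> - m)\<^sup>2"
      by (simp add: indicator_def)
  qed simp
  also have "\<dots> = 4 / m\<^sup>2 * (\<integral>\<omega>. (N \<omega> - m)\<^sup>2 \<partial>M)"
    by simp
  also have "\<dots> \<le> 4 / m\<^sup>2 * m"
    using var by (intro mult_left_mono) auto
  also have "\<dots> = 4 / m"
    by (simp add: power2_eq_square)
  finally show ?thesis
    by (simp add: N m_def)
qed

text \<open>
  The nulls up to time \<open>m\<close> are only used to secure about \<open>m \<epsilon> \<pi>\<close> discoveries, where \<open>\<pi>\<close> is the power
  at the threshold \<open>x\<close>; these raise the later levels so much that \<open>y\<close> becomes the threshold.
\<close>
lemma lond_FNR_le: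
  assumes df: "distribution_function \<Phi>" and sm: "static_mixture \<Phi> \<epsilon> \<mu> M \<theta> X"
    and \<epsilon>: "\<epsilon> > 0" and n: "n \<ge> 1" and m: "m \<le> n"
    and \<Lambda>: "\<And>i. i \<ge> 1 \<Longrightarrow> \<Lambda> i \<ge> 0"
    and x: "\<And>i. 1 \<le> i \<Longrightarrow> i \<le> m \<Longrightarrow> 1 - \<Phi> x \<le> \<Lambda> i"
    and y: "\<And>i. m < i \<Longrightarrow> i \<le> n \<Longrightarrow> 1 - \<Phi> y \<le> \<Lambda> i * (real m * (\<epsilon> * (1 - \<Phi> (x - \<mu>))) / 2 + 1)"
  shows "lond_FNR \<Phi> \<Lambda> M \<theta> X n \<le>
    4 / (real n * \<epsilon>) + 4 / (real m * (\<epsilon> * (1 - \<Phi> (x - \<mu>)))) + 2 * (real m / real n) + 2 * \<Phi> (y - \<mu>)"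
proof -
  interpret prob_space M using sm by (simp add: static_mixture_def)
  note D = distribution_functionD[OF df]
  note ind = static_mixture_indep_vars[OF sm]
  let ?\<pi> = "1 - \<Phi> (x - \<mu>)"
  define B where "B i = {\<omega> \<in> space M. X i \<omega> > x \<and> \<theta> i \<omega> = True}" for i
  define T where "T i = {\<omega> \<in> space M. \<theta> i \<omega> = True}" for i
  define U where "U i = {\<omega> \<in> space M. X i \<omega> \<le> y \<and> \<theta> i \<omega> = True}" for i
  have ev: "B i \<in> events" "T i \<in> events" "U i \<in> events" if "i \<ge> 1" for i
    using static_mixtureD(1,2)[OF sm that] by (auto simp: B_def T_def U_def)
  have prB: "prob (B i) = \<epsilon> * ?\<pi>" and prT: "prob (T i) = \<epsilon>" and prU: "prob (U i) = \<epsilon> * \<Phi> (y - \<mu>)"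
    if "i \<ge> 1" for i
    unfolding B_def T_def U_def static_mixture_prob_gt[OF sm that] static_mixture_prob_le[OF sm that]
      static_mixtureD(4)[OF sm that] by (simp_all add: shift_def)
  have indB: "indep_events B {1..m}"
  proof -
    have "indep_events (\<lambda>i. {\<omega> \<in> space M. snd (\<theta> i \<omega>, X i \<omega>) > x \<and> fst (\<theta> i \<omega>, X i \<omega>)}) {1..m}"
      by (rule indep_eventsI_indep_vars[OF indep_vars_subset[OF ind]]) auto
    then show ?thesis by (simp add: B_def[abs_def])
  qed
  have indT: "indep_events T {1..n}"
  proof -
    have "indep_events (\<lambda>i. {\<omega> \<in> space M. fst (\<theta> i \<omega>, X i \<omega>)}) {1..n}"
      by (rule indep_eventsI_indep_vars[OF indep_vars_subset[OF ind]]) auto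
    then show ?thesis by (simp add: T_def[abs_def])
  qed
  \<comment> \<open>The two bad events: too few early false nulls above \<open>x\<close>, and too
    few false nulls altogether. Each contributes its probability, since the proportion is at most
    1.\<close>
  define E1 where "E1 = {\<omega> \<in> space M. real (card {i\<in>{1..m}. \<omega> \<in> B i}) < real m * (\<epsilon> * ?\<pi>) / 2}"
  define E2 where "E2 = {\<omega> \<in> space M. real (card {i\<in>{1..n}. \<omega> \<in> T i}) < real n * \<epsilon> / 2}"
  have E1: "prob E1 \<le> 4 / (real m * (\<epsilon> * ?\<pi>))"
    using prob_count_less_half_mean[OF _ indB, of "\<epsilon> * ?\<pi>"] prB by (simp add: E1_def)
  have E2: "prob E2 \<le> 4 / (real n * \<epsilon>)"
    using prob_count_less_half_mean[OF _ indT, of \<epsilon>] prT by (simp add: E2_def)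
  have card_eq: "real (card {i\<in>I. \<omega> \<in> A i}) = (\<Sum>i\<in>I. indicator (A i) \<omega>)" if "finite I"
    for I :: "nat set" and A :: "nat \<Rightarrow> 'a set" and \<omega>
    using that by (simp add: indicator_def sum.If_cases Int_def)
  have evE: "E1 \<in> events" "E2 \<in> events"
  proof -
    have "(\<lambda>\<omega>. \<Sum>i\<in>{1..m}. indicator (B i) \<omega> :: real) \<in> borel_measurable M"
      using ev by (intro borel_measurable_sum borel_measurable_indicator) auto
    then show "E1 \<in> events"
      unfolding E1_def card_eq[OF finite_atLeastAtMost]
      by (rule borel_measurable_less) (rule borel_measurable_const)
    have "(\<lambda>\<omega>. \<Sum>i\<in>{1..n}. indicator (T i) \<omega> :: real) \<in> borel_measurable M"
      using ev by (intro borel_measurable_sum borel_measurable_indicator) auto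
    then show "E2 \<in> events"
      unfolding E2_def card_eq[OF finite_atLeastAtMost]
      by (rule borel_measurable_less) (rule borel_measurable_const)
  qed
  \<comment> \<open>\<open>?S\<close> dominates the number of missed false nulls off the bad events:
    all those up to \<open>m\<close> are given up, and later ones count only if their statistic is
    at most \<open>y\<close>. There the denominator is at least n \<epsilon> / 2, whence the factor
    in \<open>?g\<close>.\<close>
  let ?S = "\<lambda>\<omega>. (\<Sum>i\<in>{1..m}. indicator (T i) \<omega>) + (\<Sum>i\<in>{m<..n}. indicator (U i) \<omega>) :: real"
  let ?g = "\<lambda>\<omega>. indicator E1 \<omega> + indicator E2 \<omega> + 2 / (real n * \<epsilon>) * ?S \<omega>"
  have intI: "integrable M (indicator A :: _ \<Rightarrow> real)" if "A \<in> events" for A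
    using that by (intro integrable_real_indicator) (auto simp: emeasure_eq_measure)
  have intS: "integrable M (\<lambda>\<omega>. \<Sum>i\<in>{1..m}. indicator (T i) \<omega> :: real)"
    "integrable M (\<lambda>\<omega>. \<Sum>i\<in>{m<..n}. indicator (U i) \<omega> :: real)"
    using ev by (intro Bochner_Integration.integrable_sum intI; simp)+
  have "lond_FNR \<Phi> \<Lambda> M \<theta> X n \<le> (\<integral>\<omega>. ?g \<omega> \<partial>M)"
    unfolding lond_FNR_def FNR_def
  proof (rule integral_mono')
    show "integrable M ?g"
      by (intro Bochner_Integration.integrable_add integrable_mult_right intI evE intS)
    fix \<omega> assume \<omega>: "\<omega> \<in> space M"
    let ?p = "p_value \<Phi> X \<omega>"
    let ?F = "false_nulls \<theta> n \<omega>" and ?R = "lond_rejected \<Lambda> ?p n"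
    have S: "?S \<omega> \<ge> 0" by (intro add_nonneg_nonneg sum_nonneg) auto
    have fin: "finite ?F" by (simp add: false_nulls_def)
    have le1: "real (card (?F - ?R)) / real (card ?F) \<le> 1"
      using card_mono[OF fin, of "?F - ?R"] by (auto simp: divide_le_eq)
    show "real (card (?F - ?R)) / real (card ?F) \<le> ?g \<omega>"
    proof (cases "\<omega> \<in> E1 \<or> \<omega> \<in> E2")
      case True
      then have "1 \<le> (indicator E1 \<omega> + indicator E2 \<omega> :: real)"
        by (auto simp: indicator_def)
      moreover have "2 / (real n * \<epsilon>) * ?S \<omega> \<ge> 0"
        using S \<epsilon> by (intro mult_nonneg_nonneg) auto
      ultimately show ?thesis using le1 by linarith
    next
      case False
      have F: "?F = {i\<in>{1..n}. \<omega> \<in> T i}"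
        using \<omega> by (auto simp: false_nulls_def T_def)
      have cF: "real (card ?F) \<ge> real n * \<epsilon> / 2"
        using False \<omega> by (simp add: E2_def F)
      \<comment> \<open>A level is at least its weight whatever happened before, so a statistic
        above \<open>x\<close> forces a rejection and the dependence between rejections never
        matters.\<close>
      have "{i\<in>{1..m}. \<omega> \<in> B i} \<subseteq> lond_rejected \<Lambda> ?p m"
      proof
        fix i assume i: "i \<in> {i\<in>{1..m}. \<omega> \<in> B i}"
        then have "?p i \<le> 1 - \<Phi> x"
          using monoD[OF D(1), of x "X i \<omega>"] by (auto simp: p_value_def B_def)
        also have "\<dots> \<le> \<Lambda> i" using i x by auto
        also have "\<dots> \<le> lond_level \<Lambda> ?p i"
          using i \<Lambda>[of i] by (auto simp: lond_level_def mult_le_cancel_left1 distrib_left)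
        finally show "i \<in> lond_rejected \<Lambda> ?p m"
          using i by (auto simp: lond_rejected_def)
      qed
      then have "card {i\<in>{1..m}. \<omega> \<in> B i} \<le> lond_discoveries \<Lambda> ?p m"
        unfolding lond_discoveries_eq_card by (intro card_mono) (auto simp: lond_rejected_def)
      then have Dm: "real m * (\<epsilon> * ?\<pi>) / 2 \<le> real (lond_discoveries \<Lambda> ?p m)"
        using False \<omega> by (simp add: E1_def)
      have "?F - ?R \<subseteq> {i\<in>{1..m}. \<omega> \<in> T i} \<union> {i\<in>{m<..n}. \<omega> \<in> U i}"
      proof
        fix i assume i: "i \<in> ?F - ?R"
        then have i': "1 \<le> i" "i \<le> n" "\<omega> \<in> T i" "i \<notin> ?R" using F by auto
        have "X i \<omega> \<le> y" if im: "m < i"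
        proof (rule ccontr)
          assume "\<not> X i \<omega> \<le> y"
          then have "?p i \<le> 1 - \<Phi> y"
            using monoD[OF D(1), of y "X i \<omega>"] by (auto simp: p_value_def)
          also have "\<dots> \<le> \<Lambda> i * (real m * (\<epsilon> * ?\<pi>) / 2 + 1)"
            using y im i' by simp
          also have "\<dots> \<le> lond_level \<Lambda> ?p i"
          proof -
            have "lond_discoveries \<Lambda> ?p m \<le> lond_discoveries \<Lambda> ?p (i - 1)"
              using im by (intro lond_discoveries_mono) simp
            then show ?thesis
              unfolding lond_level_def using Dm \<Lambda>[OF i'(1)] by (intro mult_left_mono) auto
          qed
          finally show False using i' by (simp add: lond_rejected_def)
        qed
        then show "i \<in> {i\<in>{1..m}. \<omega> \<in> T i} \<union> {i\<in>{m<..n}. \<omega> \<in> U i}"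
          using i' by (cases "m < i") (auto simp: U_def T_def)
      qed
      then have "card (?F - ?R) \<le> card ({i\<in>{1..m}. \<omega> \<in> T i} \<union> {i\<in>{m<..n}. \<omega> \<in> U i})"
        by (intro card_mono) auto
      also have "\<dots> \<le> card {i\<in>{1..m}. \<omega> \<in> T i} + card {i\<in>{m<..n}. \<omega> \<in> U i}"
        by (rule card_Un_le)
      finally have "real (card (?F - ?R)) \<le> ?S \<omega>"
        by (simp flip: card_eq)
      then have "real (card (?F - ?R)) / real (card ?F) \<le> ?S \<omega> / (real n * \<epsilon> / 2)"
        using cF n \<epsilon> S by (intro frac_le) auto
      also have "\<dots> = 2 / (real n * \<epsilon>) * ?S \<omega>" by simp
      finally show ?thesis by (simp add: add_nonneg_nonneg add_increasing)
    qed
  next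
    fix \<omega> show "0 \<le> ?g \<omega>"
      using \<epsilon> by (intro add_nonneg_nonneg mult_nonneg_nonneg sum_nonneg) auto
  qed
  also have "(\<integral>\<omega>. ?g \<omega> \<partial>M) = prob E1 + prob E2 + 2 / (real n * \<epsilon>) * (\<integral>\<omega>. ?S \<omega> \<partial>M)"
    using intI[OF evE(1)] intI[OF evE(2)] intS evE by simp
  also have "(\<integral>\<omega>. ?S \<omega> \<partial>M) = (\<Sum>i\<in>{1..m}. prob (T i)) + (\<Sum>i\<in>{m<..n}. prob (U i))"
    using ev intI by (subst Bochner_Integration.integral_add)
      (auto simp: Bochner_Integration.integral_sum intro!: Bochner_Integration.integrable_sum)
  also have "\<dots> = real m * \<epsilon> + real (n - m) * (\<epsilon> * \<Phi> (y - \<mu>))"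
    using prT prU by simp
  also have "2 / (real n * \<epsilon>) * \<dots> = 2 * (real m / real n) + 2 * (real (n - m) / real n) * \<Phi> (y - \<mu>)"
    using \<epsilon> n by (simp add: field_simps)
  also have "\<dots> \<le> 2 * (real m / real n) + 2 * \<Phi> (y - \<mu>)"
  proof -
    have "real (n - m) / real n \<le> 1" using n by simp
    then have "2 * (real (n - m) / real n) * \<Phi> (y - \<mu>) \<le> 2 * 1 * \<Phi> (y - \<mu>)"
      using D(2) by (intro mult_mono) auto
    then show ?thesis by simp
  qed
  finally show ?thesis using E1 E2 by linarith
qed

subsection \<open>Asymptotics\<close>

lemma filterlim_powr_at_top:
  fixes p :: real
  assumes "p > 0"
  shows "filterlim (\<lambda>x. x powr p) at_top at_top"
proof -
  have lim: "filterlim (\<lambda>x. exp (p * ln x)) at_top at_top"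
    using assms by (intro filterlim_compose[OF exp_at_top] ln_at_top
        filterlim_tendsto_pos_mult_at_top[OF tendsto_const]) auto
  show ?thesis
    by (rule filterlim_mono_eventually[OF lim order_refl order_refl])
      (use eventually_gt_at_top[of 0] in eventually_elim, simp add: powr_def)
qed

lemma filterlim_ln_real_nat_at_top: "filterlim (\<lambda>n. ln (real n)) at_top sequentially"
  by (rule filterlim_compose[OF ln_at_top filterlim_real_sequentially])

lemma filterlim_real_nat_powr_at_top: "(a::real) > 0 \<Longrightarrow> filterlim (\<lambda>n. real n powr a) at_top sequentially"
  by (rule filterlim_compose[OF filterlim_powr_at_top filterlim_real_sequentially])

lemma real_nat_powr_tendsto_zero: "(a::real) > 0 \<Longrightarrow> (\<lambda>n. real n powr (-a)) \<longlonglongrightarrow> 0"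
  by (rule tendsto_neg_powr[OF _ filterlim_real_sequentially]) simp

text \<open>At this point \<open>x powr \<gamma> / \<gamma>\<close> equals \<open>s * ln n\<close>,
  so the log tail is asymptotically \<open>- s * ln n\<close>; the slack \<open>a\<close> absorbs
  the error.\<close>

lemma agg_right_tail_bounds:
  assumes df: "distribution_function \<Phi>" and agg: "agg_right \<Phi> \<gamma>" and s: "s > 0" and a: "a > 0"
  shows "\<forall>\<^sub>F n in sequentially.
    real n powr (-(s + a)) \<le> 1 - \<Phi> ((\<gamma> * s * ln (real n)) powr (1 / \<gamma>)) \<and>
    1 - \<Phi> ((\<gamma> * s * ln (real n)) powr (1 / \<gamma>)) \<le> real n powr (-(s - a))"
proof -
  have \<gamma>: "\<gamma> > 0" and lim: "((\<lambda>x. x powr (-\<gamma>) * ln (1 - \<Phi> x)) \<longlongrightarrow> - (1 / \<gamma>)) at_top"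
    using agg by (auto simp: agg_right_def)
  define x where "x n = (\<gamma> * s * ln (real n)) powr (1 / \<gamma>)" for n
  have "filterlim (\<lambda>n. \<gamma> * s * ln (real n)) at_top sequentially"
    using \<gamma> s by (intro filterlim_tendsto_pos_mult_at_top[OF tendsto_const] filterlim_ln_real_nat_at_top) auto
  then have "filterlim x at_top sequentially"
    unfolding x_def using \<gamma> by (intro filterlim_compose[OF filterlim_powr_at_top]) auto
  from filterlim_compose[OF lim this]
  have T: "(\<lambda>n. x n powr (-\<gamma>) * ln (1 - \<Phi> (x n))) \<longlonglongrightarrow> - (1 / \<gamma>)" .
  \<comment> \<open>This radius around the limit becomes exactly \<open>a * ln n\<close> after
    multiplication by \<open>\<gamma> * s * ln n\<close>.\<close>
  have "a / (\<gamma> * s) > 0" using \<gamma> s a by simp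
  then have "\<forall>\<^sub>F n in sequentially. - (1 / \<gamma>) - a / (\<gamma> * s) < x n powr (-\<gamma>) * ln (1 - \<Phi> (x n))"
    "\<forall>\<^sub>F n in sequentially. x n powr (-\<gamma>) * ln (1 - \<Phi> (x n)) < - (1 / \<gamma>) + a / (\<gamma> * s)"
    "\<forall>\<^sub>F n in sequentially. x n powr (-\<gamma>) * ln (1 - \<Phi> (x n)) < 0"
    using \<gamma> by (auto intro: order_tendstoD[OF T])
  with eventually_ge_at_top[of 2] show ?thesis
    unfolding x_def[symmetric]
  proof eventually_elim
    case (elim n)
    define L where "L = ln (real n)"
    define l where "l = ln (1 - \<Phi> (x n))"
    have L: "L > 0" using elim(1) by (simp add: L_def)
    have K: "\<gamma> * s * L > 0" using \<gamma> s L by simp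
    have "x n powr (-\<gamma>) = (\<gamma> * s * L) powr (-1)"
      using \<gamma> by (simp add: x_def L_def powr_powr)
    also have "\<dots> = 1 / (\<gamma> * s * L)"
      using K by (simp add: powr_minus_divide)
    finally have xn: "x n powr (-\<gamma>) * l = l / (\<gamma> * s * L)" by simp
    \<comment> \<open>A strictly negative logarithm rules out a zero tail, for which
      \<open>ln 0 = 0\<close>, so that \<open>exp l\<close> really is the tail.\<close>
    have "l / (\<gamma> * s * L) < 0" using elim(4) xn by (simp add: l_def)
    then have "l < 0" using K by (simp add: divide_less_0_iff)
    then have "1 - \<Phi> (x n) \<noteq> 0" by (auto simp: l_def)
    then have pos: "1 - \<Phi> (x n) > 0" using distribution_functionD(3)[OF df, of "x n"] by linarith
    have "- (1 / \<gamma>) - a / (\<gamma> * s) < l / (\<gamma> * s * L)" "l / (\<gamma> * s * L) < - (1 / \<gamma>) + a / (\<gamma> * s)"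
      using elim(2,3) xn by (simp_all add: l_def)
    moreover have "- (1 / \<gamma>) - a / (\<gamma> * s) = (-(s + a) * L) / (\<gamma> * s * L)"
      "- (1 / \<gamma>) + a / (\<gamma> * s) = (-(s - a) * L) / (\<gamma> * s * L)"
      using \<gamma> s L by (simp_all add: field_simps)
    ultimately have "(-(s + a) * L) / (\<gamma> * s * L) < l / (\<gamma> * s * L)"
      "l / (\<gamma> * s * L) < (-(s - a) * L) / (\<gamma> * s * L)" by simp_all
    then have "-(s + a) * L < l" "l < -(s - a) * L"
      using divide_right_mono[OF _ less_imp_le[OF K]] by (meson not_less)+
    then have "exp (-(s + a) * L) \<le> exp l" "exp l \<le> exp (-(s - a) * L)"
      by simp_all
    moreover have "exp l = 1 - \<Phi> (x n)" using pos by (simp add: l_def)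
    moreover have "real n powr c = exp (c * L)" for c
      using elim(1) by (simp add: powr_def L_def)
    ultimately show ?case by simp
  qed
qed

text \<open>Thresholds and shift share one growing scale, so a gap between them is a fixed multiple
  of it.\<close>

lemma powr_scaled_diff:
  fixes \<gamma> :: real
  shows "(\<gamma> * s * L) powr p - (\<gamma> * r * L) powr p = (\<gamma> * L) powr p * (s powr p - r powr p)"
  by (simp add: powr_mult algebra_simps)

section \<open>Normalisation and size of the weights\<close>

lemma power_weights_eq:
  assumes pw: "power_weights \<nu> q \<Lambda>" and \<nu>: "\<nu> > 1" and i: "i \<ge> 1"
  shows "\<Lambda> i = q / (\<Sum>j. real (Suc j) powr (-\<nu>)) * real i powr (-\<nu>)"
    and "(\<Sum>j. real (Suc j) powr (-\<nu>)) > 0"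
proof -
  let ?Z = "\<Sum>j. real (Suc j) powr (-\<nu>)"
  have sum: "summable (\<lambda>j. real (Suc j) powr (-\<nu>))"
    using \<nu> by (subst summable_Suc_iff) (simp add: summable_real_powr_iff)
  then show Z: "?Z > 0" by (rule suminf_pos) simp
  obtain c where c: "\<And>i. i \<ge> 1 \<Longrightarrow> \<Lambda> i = c * real i powr (-\<nu>)" and q: "(\<lambda>i. \<Lambda> (Suc i)) sums q"
    using pw by (auto simp: power_weights_def)
  have "(\<lambda>i. c * real (Suc i) powr (-\<nu>)) sums (c * ?Z)"
    using sum by (intro sums_mult summable_sums)
  then have "(\<lambda>i. \<Lambda> (Suc i)) sums (c * ?Z)"
    by (simp add: c)
  then have "q = c * ?Z" using q sums_unique2 by blast
  then have "c = q / ?Z" using Z by (simp add: field_simps)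
  then show "\<Lambda> i = q / ?Z * real i powr (-\<nu>)" using c[OF i] by simp
qed

lemma power_weights_nonneg:
  assumes "power_weights \<nu> q \<Lambda>" "\<nu> > 1" "q > 0" "i \<ge> 1"
  shows "\<Lambda> i \<ge> 0"
  using power_weights_eq[OF assms(1,2,4)] assms(3) by simp

lemma power_weights_sum_le:
  assumes pw: "power_weights \<nu> q \<Lambda>" and \<nu>: "\<nu> > 1" and q: "q > 0"
  shows "(\<Sum>i=1..n. \<Lambda> i) \<le> q"
proof -
  have S: "(\<lambda>i. \<Lambda> (Suc i)) sums q" using pw by (simp add: power_weights_def)
  have "(\<Sum>i=1..n. \<Lambda> i) = (\<Sum>i<n. \<Lambda> (Suc i))"
    by (simp add: sum.atLeast1_atMost_eq)
  also have "\<dots> \<le> (\<Sum>i. \<Lambda> (Suc i))"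
    using S power_weights_nonneg[OF assms] by (intro sum_le_suminf) (auto simp: sums_iff)
  also have "\<dots> = q" using S by (simp add: sums_iff)
  finally show ?thesis .
qed

text \<open>The slack \<open>a\<close> absorbs both \<open>q n\<close> and the normalising sum,
  which does not depend on \<open>n\<close>; up to time \<open>n\<close> the smallest weight is the
  last one.\<close>

lemma power_weights_eventually_ge:
  assumes pw: "\<forall>n\<ge>1. power_weights \<nu> (q n) (\<Lambda> n)" and \<nu>: "\<nu> > 1"
    and q: "filterlim (\<lambda>n. real n powr a * q n) at_top sequentially"
  shows "\<forall>\<^sub>F n in sequentially. \<forall>i. 1 \<le> i \<longrightarrow> i \<le> n \<longrightarrow> real n powr (-(\<nu> + a)) \<le> \<Lambda> n i"
proof -
  let ?Z = "\<Sum>j. real (Suc j) powr (-\<nu>)"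
  have "\<forall>\<^sub>F n in sequentially. ?Z \<le> real n powr a * q n"
    using q by (simp add: filterlim_at_top)
  with eventually_ge_at_top[of 1] show ?thesis
  proof eventually_elim
    case (elim n)
    show ?case
    proof safe
      fix i assume i: "1 \<le> i" "i \<le> n"
      note eq = power_weights_eq[OF pw[rule_format, OF elim(1)] \<nu> i(1)]
      have "real n powr (-(\<nu> + a)) = real n powr (-a) * real n powr (-\<nu>)"
        by (simp add: algebra_simps flip: powr_add)
      also have "\<dots> \<le> q n / ?Z * real i powr (-\<nu>)"
      proof (rule mult_mono)
        show "real n powr (-a) \<le> q n / ?Z"
          using elim eq(2) by (simp add: powr_minus field_simps)
        then show "0 \<le> q n / ?Z" using powr_ge_zero order_trans by blast
        show "real n powr (-\<nu>) \<le> real i powr (-\<nu>)"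
          using i \<nu> by (intro powr_mono2') auto
      qed simp
      finally show "real n powr (-(\<nu> + a)) \<le> \<Lambda> n i" using eq(1) by simp
    qed
  qed
qed

section \<open>Passage to the limit\<close>

lemma lond_FNR_nonneg: "lond_FNR \<Phi> \<Lambda> M \<theta> X n \<ge> 0"
  unfolding lond_FNR_def FNR_def by simp

lemma lond_FDR_nonneg: "lond_FDR \<Phi> \<Lambda> M \<theta> X n \<ge> 0"
  unfolding lond_FDR_def FDR_def by simp

text \<open>Common end of the cases r \<le> \<nu> and r > \<nu>: once the late levels are at least
  \<open>n powr (-s)\<close> with \<open>s < r\<close>, their threshold falls below the shift by an
  amount tending to infinity.\<close>

lemma lond_FNR_tendsto_zero:
  fixes M :: "nat \<Rightarrow> 'a measure"
  assumes df: "distribution_function \<Phi>" and agg: "agg_right \<Phi> \<gamma>"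
    and \<beta>: "\<beta> < 1" and s: "0 < s" "s < r"
    and sm: "\<forall>n\<ge>1. static_mixture \<Phi> (real n powr (-\<beta>)) (\<mu> n) (M n) (\<theta> n) (X n)"
    and \<mu>: "\<And>n. \<mu> n = (\<gamma> * r * ln (real n)) powr (1 / \<gamma>)"
    and \<Lambda>: "\<And>n i. n \<ge> 1 \<Longrightarrow> i \<ge> 1 \<Longrightarrow> \<Lambda> n i \<ge> 0"
    and m: "(\<lambda>n. real (m n) / real n) \<longlonglongrightarrow> 0"
    and G: "(\<lambda>n. 1 / (real (m n) * (real n powr (-\<beta>) * (1 - \<Phi> (x n - \<mu> n))))) \<longlonglongrightarrow> 0"
    and x: "\<forall>\<^sub>F n in sequentially. \<forall>i. 1 \<le> i \<longrightarrow> i \<le> m n \<longrightarrow> i \<le> n \<longrightarrow> 1 - \<Phi> (x n) \<le> \<Lambda> n i"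
    and y: "\<forall>\<^sub>F n in sequentially. \<forall>i. m n < i \<longrightarrow> i \<le> n \<longrightarrow>
      real n powr (-s) \<le> \<Lambda> n i * (real (m n) * (real n powr (-\<beta>) * (1 - \<Phi> (x n - \<mu> n))) / 2 + 1)"
  shows "(\<lambda>n. lond_FNR \<Phi> (\<Lambda> n) (M n) (\<theta> n) (X n) n) \<longlonglongrightarrow> 0"
proof -
  have \<gamma>: "\<gamma> > 0" using agg by (simp add: agg_right_def)
  let ?G = "\<lambda>n. real (m n) * (real n powr (-\<beta>) * (1 - \<Phi> (x n - \<mu> n)))"
  \<comment> \<open>The late threshold \<open>z\<close> gets the midpoint exponent of
    \<open>s\<close> and \<open>r\<close>: above \<open>s\<close>, so that its tail is at most
    \<open>n powr (-s)\<close>, and below \<open>r\<close>, so that \<open>z n - \<mu> n\<close>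
    tends to minus infinity.\<close>
  define a where "a = (r - s) / 2"
  have a: "a > 0" and sa: "s + a < r" using s by (simp_all add: a_def field_simps)
  define z where "z n = (\<gamma> * (s + a) * ln (real n)) powr (1 / \<gamma>)" for n
  have "\<forall>\<^sub>F n in sequentially. 1 - \<Phi> (z n) \<le> real n powr (-s)"
    using agg_right_tail_bounds[OF df agg _ a, of "s + a"] s a
    by (auto simp: z_def elim: eventually_mono)
  moreover have "\<forall>\<^sub>F n in sequentially. real (m n) / real n < 1"
    using m by (rule order_tendstoD) simp
  ultimately have ub: "\<forall>\<^sub>F n in sequentially. lond_FNR \<Phi> (\<Lambda> n) (M n) (\<theta> n) (X n) n \<le>
      4 * real n powr (-(1 - \<beta>)) + 4 * (1 / ?G n) + 2 * (real (m n) / real n) + 2 * \<Phi> (z n - \<mu> n)"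
    using x y eventually_ge_at_top[of 1]
  proof eventually_elim
    case (elim n)
    have mn: "m n \<le> n" using elim by (simp add: divide_less_eq)
    have "lond_FNR \<Phi> (\<Lambda> n) (M n) (\<theta> n) (X n) n \<le>
        4 / (real n * real n powr (-\<beta>)) + 4 / ?G n + 2 * (real (m n) / real n) + 2 * \<Phi> (z n - \<mu> n)"
    proof (rule lond_FNR_le[OF df])
      show "static_mixture \<Phi> (real n powr (-\<beta>)) (\<mu> n) (M n) (\<theta> n) (X n)"
        using sm elim by blast
      show "1 - \<Phi> (z n) \<le> \<Lambda> n i * (?G n / 2 + 1)" if "m n < i" "i \<le> n" for i
        using elim that by (meson order_trans)
    qed (use elim mn \<Lambda> in auto)
    moreover have "real n * real n powr (-\<beta>) = real n powr (1 - \<beta>)"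
      using elim by (simp add: powr_mult_base)
    then have "4 / (real n * real n powr (-\<beta>)) = 4 * real n powr (-(1 - \<beta>))"
      by (simp only: powr_minus_divide)
    ultimately show ?case by simp
  qed
  have "filterlim (\<lambda>n. z n - \<mu> n) at_bot sequentially"
  proof -
    define b where "b = r powr (1 / \<gamma>) - (s + a) powr (1 / \<gamma>)"
    have b: "b > 0" unfolding b_def using sa s a \<gamma> by (simp add: powr_less_mono2)
    have "filterlim (\<lambda>n. \<gamma> * ln (real n)) at_top sequentially"
      using \<gamma> by (intro filterlim_tendsto_pos_mult_at_top[OF tendsto_const] filterlim_ln_real_nat_at_top) auto
    then have "filterlim (\<lambda>n. (\<gamma> * ln (real n)) powr (1 / \<gamma>)) at_top sequentially"
      using \<gamma> by (intro filterlim_compose[OF filterlim_powr_at_top]) auto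
    then have "filterlim (\<lambda>n. b * (\<gamma> * ln (real n)) powr (1 / \<gamma>)) at_top sequentially"
      using b by (intro filterlim_tendsto_pos_mult_at_top[OF tendsto_const]) auto
    then have lim: "filterlim (\<lambda>n. - (b * (\<gamma> * ln (real n)) powr (1 / \<gamma>))) at_bot sequentially"
      by (simp add: filterlim_uminus_at_bot)
    show ?thesis
    proof (rule filterlim_mono_eventually[OF lim order_refl order_refl])
      show "\<forall>\<^sub>F n in sequentially. - (b * (\<gamma> * ln (real n)) powr (1 / \<gamma>)) = z n - \<mu> n"
        using eventually_ge_at_top[of 1]
      proof eventually_elim
        case (elim n)
        have "z n - \<mu> n = (\<gamma> * ln (real n)) powr (1 / \<gamma>) * ((s + a) powr (1 / \<gamma>) - r powr (1 / \<gamma>))"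
          unfolding z_def \<mu> by (rule powr_scaled_diff)
        then show ?case by (simp add: b_def algebra_simps)
      qed
    qed
  qed
  then have \<Phi>: "(\<lambda>n. \<Phi> (z n - \<mu> n)) \<longlonglongrightarrow> 0"
    by (rule filterlim_compose[OF distribution_functionD(4)[OF df]])
  have lim: "(\<lambda>n. 4 * real n powr (-(1 - \<beta>)) + 4 * (1 / ?G n) + 2 * (real (m n) / real n) +
      2 * \<Phi> (z n - \<mu> n)) \<longlonglongrightarrow> 4 * 0 + 4 * 0 + 2 * 0 + 2 * 0"
    using \<beta> by (intro tendsto_add tendsto_mult tendsto_const G m \<Phi> real_nat_powr_tendsto_zero) simp
  show ?thesis
    by (rule tendsto_sandwich[OF _ ub tendsto_const]) (use lim in \<open>simp_all add: lond_FNR_nonneg\<close>)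
qed

text \<open>Right-continuity at \<nu>. The excess of t over \<nu> pays for the slack in the weights
  and keeps the gap to the shift positive even if r = \<nu>.\<close>

lemma exists_exponent_above:
  fixes \<gamma> \<nu> r B :: real
  assumes "\<gamma> > 0" "\<nu> > 0" "r \<le> \<nu>" "(\<nu> powr (1 / \<gamma>) - r powr (1 / \<gamma>)) powr \<gamma> < B"
    and "r \<ge> 0"
  shows "\<exists>t>\<nu>. (t powr (1 / \<gamma>) - r powr (1 / \<gamma>)) powr \<gamma> < B"
proof -
  \<comment> \<open>If r = \<nu>, the base tends to 0, where the limit rule for \<open>powr\<close>
    asks for a nonnegative base.\<close>
  have "\<forall>\<^sub>F t in at_right \<nu>. 0 \<le> t powr (1 / \<gamma>) - r powr (1 / \<gamma>)"
    using eventually_at_right_less[of \<nu>]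
    by eventually_elim (use assms in \<open>auto intro!: powr_mono2\<close>)
  then have "((\<lambda>t. (t powr (1 / \<gamma>) - r powr (1 / \<gamma>)) powr \<gamma>) \<longlongrightarrow>
      (\<nu> powr (1 / \<gamma>) - r powr (1 / \<gamma>)) powr \<gamma>) (at_right \<nu>)"
    using assms by (intro tendsto_powr' tendsto_diff tendsto_powr tendsto_const tendsto_ident_at) auto
  then have "\<forall>\<^sub>F t in at_right \<nu>. (t powr (1 / \<gamma>) - r powr (1 / \<gamma>)) powr \<gamma> < B"
    using assms by (intro order_tendstoD)
  with eventually_at_right_less[of \<nu>] have "\<forall>\<^sub>F t in at_right \<nu>.
      \<nu> < t \<and> (t powr (1 / \<gamma>) - r powr (1 / \<gamma>)) powr \<gamma> < B"
    by eventually_elim simp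
  then show ?thesis
    using eventually_happens'[OF trivial_limit_at_right_real] by blast
qed

theorem theorem2:
  fixes \<Phi> :: "real \<Rightarrow> real" and \<gamma> \<beta> r \<nu> :: real and q :: "nat \<Rightarrow> real"
    and \<Lambda> :: "nat \<Rightarrow> nat \<Rightarrow> real"
    and M :: "nat \<Rightarrow> 'a measure"
    and \<theta> :: "nat \<Rightarrow> nat \<Rightarrow> 'a \<Rightarrow> bool"
    and X :: "nat \<Rightarrow> nat \<Rightarrow> 'a \<Rightarrow> real"
  assumes "distribution_function \<Phi>"
    and "continuous_on UNIV \<Phi>"
    and "\<gamma> \<ge> 1"
    and "agg_right \<Phi> \<gamma>"
    and "0 < \<beta>" and "\<beta> < 1"
    and "r \<ge> 0"
    and "\<nu> > 1"
    and "r \<le> \<nu> \<or> \<gamma> \<in> \<int>"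
    and "\<forall>n\<ge>1. q n > 0"
    and "\<forall>a>0. filterlim (\<lambda>n. real n powr a * q n) at_top sequentially"
    and "\<forall>n\<ge>1. static_mixture \<Phi> (real n powr (-\<beta>)) ((\<gamma> * r * ln (real n)) powr (1 / \<gamma>))
           (M n) (\<theta> n) (X n)"
    and "\<forall>n\<ge>1. power_weights \<nu> (q n) (\<Lambda> n)"
    and "r > \<beta> + real_power (\<nu> powr (1 / \<gamma>) - r powr (1 / \<gamma>)) \<gamma> + \<nu> - 1"
  shows "(\<lambda>n. lond_FNR \<Phi> (\<Lambda> n) (M n) (\<theta> n) (X n) n) \<longlonglongrightarrow> 0
    \<and> (q \<longlonglongrightarrow> 0 \<longrightarrow>
        (\<lambda>n. lond_FDR \<Phi> (\<Lambda> n) (M n) (\<theta> n) (X n) n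
            + lond_FNR \<Phi> (\<Lambda> n) (M n) (\<theta> n) (X n) n) \<longlonglongrightarrow> 0)"
proof -
  note df = assms(1) and cont = assms(2) and agg = assms(4) and \<beta> = assms(5,6) and r = assms(7)
    and \<nu> = assms(8) and qpos = assms(10) and q = assms(11) and sm = assms(12) and pw = assms(13)
  have \<gamma>: "\<gamma> > 0" using assms(3) by simp
  define \<mu> where "\<mu> n = (\<gamma> * r * ln (real n)) powr (1 / \<gamma>)" for n
  have sm': "\<forall>n\<ge>1. static_mixture \<Phi> (real n powr (-\<beta>)) (\<mu> n) (M n) (\<theta> n) (X n)"
    using sm by (simp add: \<mu>_def)
  have \<Lambda>: "\<Lambda> n i \<ge> 0" if "n \<ge> 1" "i \<ge> 1" for n i
    using power_weights_nonneg[OF _ \<nu>] pw qpos that by blast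
  have level: "\<forall>\<^sub>F n in sequentially. \<forall>i. 1 \<le> i \<longrightarrow> i \<le> n \<longrightarrow> real n powr (-(\<nu> + a)) \<le> \<Lambda> n i" if "a > 0" for a
    using power_weights_eventually_ge[OF pw \<nu>] q that by blast
  have FNR: "(\<lambda>n. lond_FNR \<Phi> (\<Lambda> n) (M n) (\<theta> n) (X n) n) \<longlonglongrightarrow> 0"
  proof (cases "r \<le> \<nu>")
    case False
    define a where "a = (r - \<nu>) / 2"
    have a: "a > 0" "\<nu> + a < r" using False by (simp_all add: a_def field_simps)
    show ?thesis
    \<comment> \<open>The early block is empty and its threshold 0 is a dummy; the term for early
      discoveries is 1/0 = 0.\<close>
    proof (rule lond_FNR_tendsto_zero[where m = "\<lambda>_. 0" and x = "\<lambda>_. 0" and s = "\<nu> + a",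
          OF df agg \<beta>(2) _ a(2) sm' \<mu>_def \<Lambda>])
      show "\<forall>\<^sub>F n in sequentially. \<forall>i. 0 < i \<longrightarrow> i \<le> n \<longrightarrow> real n powr (- (\<nu> + a)) \<le>
          \<Lambda> n i * (real 0 * (real n powr (-\<beta>) * (1 - \<Phi> (0 - \<mu> n))) / 2 + 1)"
        using level[OF a(1)] by (simp add: Suc_le_eq)
    qed (use \<nu> a in auto)
  next
    case True
    define \<rho> where "\<rho> = (\<nu> powr (1 / \<gamma>) - r powr (1 / \<gamma>)) powr \<gamma>"
    define g where "g = r - (\<beta> + \<rho> + \<nu> - 1)"
    have "\<nu> powr (1 / \<gamma>) - r powr (1 / \<gamma>) \<ge> 0"
      using True r \<gamma> by (simp add: powr_mono2)
    then have g: "g > 0" using assms(14) by (simp add: real_power_def \<rho>_def g_def)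
    obtain t where t: "t > \<nu>" and \<rho>t: "(t powr (1 / \<gamma>) - r powr (1 / \<gamma>)) powr \<gamma> < \<rho> + g / 2"
      using exists_exponent_above[OF \<gamma> _ True, of "\<rho> + g / 2"] g \<nu> r by (auto simp: \<rho>_def)
    have t0: "t > 0" using t \<nu> by simp
    define b where "b = t powr (1 / \<gamma>) - r powr (1 / \<gamma>)"
    have b: "b > 0" unfolding b_def using True t r \<gamma> by (simp add: powr_less_mono2)
    define \<sigma> where "\<sigma> = b powr \<gamma>"
    have \<sigma>: "\<sigma> > 0" "\<sigma> < \<rho> + g / 2" using b \<rho>t by (simp_all add: \<sigma>_def b_def)
    \<comment> \<open>Of the slack \<open>g\<close>, the passage from \<rho> to \<sigma> costs less
      than g/2, and the four copies of \<open>a\<close> in \<open>s\<close> at most g/4, leaving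
      \<open>s < r\<close>. The second bound puts the tail at \<open>x\<close> below the
      weights.\<close>
    define a where "a = min (g / 16) ((t - \<nu>) / 2)"
    have a: "a > 0" "a \<le> g / 16" "\<nu> + a \<le> t - a" using g t by (auto simp: a_def min_def field_simps)
    \<comment> \<open>\<open>n powr \<kappa>\<close> bounds the expected early discoveries from
      below: block length, mixture weight and power have exponents 1 - a, -\<beta> and -(\<sigma> +
      a).\<close>
    define \<kappa> where "\<kappa> = 1 - \<beta> - \<sigma> - 2 * a"
    \<comment> \<open>The late levels multiply \<open>n powr (-(\<nu> + a))\<close> by
      \<open>n powr (\<kappa> - a)\<close>; the extra \<open>a\<close> absorbs the factor 1/2 from
      the half mean.\<close>
    define s where "s = \<nu> + 2 * a - \<kappa>"
    \<comment> \<open>Here r \<le> \<nu> enters: it gives 1 - \<beta> - \<rho> \<ge> g, and \<kappa>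
      loses less than 5g/8 of that.\<close>
    have \<kappa>: "\<kappa> > 0" using True \<sigma> a g unfolding \<kappa>_def g_def by argo
    have s: "0 < s" "s < r" using \<nu> \<beta> \<sigma> a g unfolding s_def \<kappa>_def g_def by argo+
    define m where "m n = nat \<lceil>real n powr (1 - a)\<rceil>" for n
    define x where "x n = (\<gamma> * t * ln (real n)) powr (1 / \<gamma>)" for n
    let ?G = "\<lambda>n. real (m n) * (real n powr (-\<beta>) * (1 - \<Phi> (x n - \<mu> n)))"
    have m_ge: "real n powr (1 - a) \<le> real (m n)" for n
      unfolding m_def by (rule real_nat_ceiling_ge)
    have m_le: "real (m n) \<le> real n powr (1 - a) + 1" for n
      unfolding m_def by (simp add: of_nat_nat)
    \<comment> \<open>The gap is again a threshold, of exponent \<sigma>, so the tail bounds also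
      give the power at \<open>x\<close>.\<close>
    have gap: "x n - \<mu> n = (\<gamma> * \<sigma> * ln (real n)) powr (1 / \<gamma>)" for n
    proof -
      have "x n - \<mu> n = (\<gamma> * ln (real n)) powr (1 / \<gamma>) * b"
        unfolding x_def \<mu>_def b_def by (rule powr_scaled_diff)
      also have "b = \<sigma> powr (1 / \<gamma>)"
        using b \<gamma> by (simp add: \<sigma>_def powr_powr)
      finally show ?thesis by (simp add: powr_mult)
    qed
    have G: "\<forall>\<^sub>F n in sequentially. real n powr \<kappa> \<le> ?G n"
      using agg_right_tail_bounds[OF df agg \<sigma>(1) a(1)]
    proof eventually_elim
      case (elim n)
      have "real n powr \<kappa> = real n powr (1 - a) * (real n powr (-\<beta>) * real n powr (-(\<sigma> + a)))"
        by (simp add: \<kappa>_def algebra_simps flip: powr_add)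
      also have "\<dots> \<le> ?G n"
        using elim m_ge by (intro mult_mono) (auto simp: gap)
      finally show ?case .
    qed
    show ?thesis
    proof (rule lond_FNR_tendsto_zero[where m = m and x = x, OF df agg \<beta>(2) s sm' \<mu>_def \<Lambda>])
      show "(\<lambda>n. real (m n) / real n) \<longlonglongrightarrow> 0"
      proof (rule tendsto_sandwich[OF _ _ tendsto_const])
        show "\<forall>\<^sub>F n in sequentially. real (m n) / real n \<le> real n powr (-a) + 1 / real n"
          using eventually_ge_at_top[of 1]
        proof eventually_elim
          case (elim n)
          then have "real n powr (-a) * real n = real n powr (1 - a)"
            by (simp add: powr_mult_base mult.commute)
          then show ?case
            using elim m_le[of n] by (simp add: field_simps)
        qed
        show "(\<lambda>n. real n powr (-a) + 1 / real n) \<longlonglongrightarrow> 0"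
          using tendsto_add[OF real_nat_powr_tendsto_zero[OF a(1)] lim_1_over_n[where 'a = real]] by simp
      qed simp
      show "(\<lambda>n. 1 / ?G n) \<longlonglongrightarrow> 0"
      proof (rule tendsto_sandwich[OF _ _ tendsto_const real_nat_powr_tendsto_zero[OF \<kappa>]])
        show "\<forall>\<^sub>F n in sequentially. 1 / ?G n \<le> real n powr (-\<kappa>)"
          using G eventually_ge_at_top[of 1]
        proof eventually_elim
          case (elim n)
          then have "1 / ?G n \<le> 1 / real n powr \<kappa>"
            by (intro frac_le) auto
          then show ?case by (simp add: powr_minus_divide)
        qed
        show "\<forall>\<^sub>F n in sequentially. 0 \<le> 1 / ?G n"
          using distribution_functionD(3)[OF df] by (intro always_eventually allI) simp
      qed
      show "\<forall>\<^sub>F n in sequentially. \<forall>i. 1 \<le> i \<longrightarrow> i \<le> m n \<longrightarrow> i \<le> n \<longrightarrow> 1 - \<Phi> (x n) \<le> \<Lambda> n i"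
        using agg_right_tail_bounds[OF df agg t0 a(1)] level[OF a(1)] eventually_ge_at_top[of 1]
      proof eventually_elim
        case (elim n)
        then have "real n powr (-(t - a)) \<le> real n powr (-(\<nu> + a))"
          using a(3) by (intro powr_mono) auto
        then show ?case using elim by (force simp: x_def)
      qed
      show "\<forall>\<^sub>F n in sequentially. \<forall>i. m n < i \<longrightarrow> i \<le> n \<longrightarrow>
          real n powr (-s) \<le> \<Lambda> n i * (?G n / 2 + 1)"
        using G level[OF a(1)] filterlim_real_nat_powr_at_top[OF a(1), unfolded filterlim_at_top, rule_format, of 2]
      proof (eventually_elim, safe)
        fix n i assume *: "real n powr \<kappa> \<le> ?G n" "m n < i" "i \<le> n" "2 \<le> real n powr a"
          "\<forall>i. 1 \<le> i \<longrightarrow> i \<le> n \<longrightarrow> real n powr (-(\<nu> + a)) \<le> \<Lambda> n i"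
        have "real n powr (-s) = real n powr (-(\<nu> + a)) * real n powr (\<kappa> - a)"
          by (simp add: s_def algebra_simps flip: powr_add)
        also have "\<dots> \<le> \<Lambda> n i * (?G n / 2 + 1)"
        proof (rule mult_mono)
          have "2 * real n powr (\<kappa> - a) \<le> real n powr a * real n powr (\<kappa> - a)"
            using *(4) by (intro mult_right_mono) auto
          also have "\<dots> = real n powr \<kappa>" by (simp flip: powr_add)
          finally show "real n powr (\<kappa> - a) \<le> ?G n / 2 + 1" using *(1) by linarith
          show "real n powr (-(\<nu> + a)) \<le> \<Lambda> n i" using * by auto
          show "0 \<le> \<Lambda> n i" using * by (intro \<Lambda>) auto
        qed simp
        finally show "real n powr (-s) \<le> \<Lambda> n i * (?G n / 2 + 1)" .
      qed
    qed auto
  qed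
  have FDR: "(\<lambda>n. lond_FDR \<Phi> (\<Lambda> n) (M n) (\<theta> n) (X n) n) \<longlonglongrightarrow> 0" if "q \<longlonglongrightarrow> 0"
  proof (rule tendsto_sandwich[OF _ _ tendsto_const that])
    show "\<forall>\<^sub>F n in sequentially. lond_FDR \<Phi> (\<Lambda> n) (M n) (\<theta> n) (X n) n \<le> q n"
      using eventually_ge_at_top[of 1]
    proof eventually_elim
      case (elim n)
      have "real n powr (-\<beta>) \<le> real n powr 0"
        using elim \<beta> by (intro powr_mono) auto
      then have "lond_FDR \<Phi> (\<Lambda> n) (M n) (\<theta> n) (X n) n \<le> (\<Sum>i=1..n. \<Lambda> n i)"
        using sm elim \<Lambda> by (intro lond_FDR_le_sum[OF df cont]) auto
      also have "\<dots> \<le> q n"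
        using pw qpos elim by (intro power_weights_sum_le[OF _ \<nu>]) auto
      finally show ?case .
    qed
  qed (simp add: lond_FDR_nonneg)
  show ?thesis
    using FNR FDR tendsto_add[of _ 0 sequentially _ 0] by auto
qed

end
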